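(* Let $\lambda,\lambda'\vdash n$ be two partitions of $n$ having the same first part $\lambda_1=\lambda'_1$. If $\lambda\unlhd\lambda'$ in the dominance order, then $$|\eta_{\lambda}|<|\eta_{\lambda'}|.$$
   Context: A partition $\lambda\vdash n$ is a weakly decreasing sequence $\lambda_1\ge\cdots\ge\lambda_r\ge 1$ of positive integers with sum $n$; set $\lambda_i=0$ for $i>r$. Dominance order: $\lambda\unlhd\lambda'$ means $\lambda_1+\cdots+\lambda_k\le\lambda'_1+\cdots+\lambda'_k$ for all positive integers $k$. The derangement graph $\Gamma_n$ is the Cayley graph of the symmetric group $\mathcal S_n$ whose connection set is the set $\mathcal D_n$ of derangements (fixed-point-free permutations) of $\{1,\dots,n\}$. Its eigenvalues are indexed by partitions $\lambda\vdash n$ and are $$\eta_\lambda=\frac{1}{\chi_\lambda(1)}\sum_{s\in\mathcal D_n}\chi_\lambda(s),$$ where $\chi_\lambda$ is the irreducible character of $\mathcal S_n$ indexed by $\lambda$ (standard labelling: $(n)$ is the trivial character, $(1^n)$ the sign character).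
   Formalization: The strict inequality is proved only for λ≠λ' and not when λ_1=λ'_1=3 with λ'_2≤2, where it fails (e.g. (3,1,1) and (3,2) both give 4); in these excluded cases |η_λ|≤|η_λ'| is proved instead. *)

theory Defs
  imports Complex_Main "HOL-Library.Function_Algebras" "HOL-Combinatorics.Permutations"
begin

text \<open>A partition is a list of its positive parts. Indices of rows, columns and parts
  start at 0, so \<open>part lam 0\<close> is the first part.\<close>

definition is_partition :: "nat \<Rightarrow> nat list \<Rightarrow> bool" where
  "is_partition n lam \<longleftrightarrow>
     sorted_wrt (\<ge>) lam \<and> (\<forall>p\<in>set lam. 1 \<le> p) \<and> sum_list lam = n"

definition part :: "nat list \<Rightarrow> nat \<Rightarrow> nat" where
  "part lam i = (if i < length lam then lam ! i else 0)"

definition dominated_by :: "nat list \<Rightarrow> nat list \<Rightarrow> bool" where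
  "dominated_by lam mu \<longleftrightarrow> (\<forall>k\<ge>1. (\<Sum>i<k. part lam i) \<le> (\<Sum>i<k. part mu i))"

text \<open>The complex vector space of all functions \<open>'a \<Rightarrow> complex\<close>, and the trace of a linear
  operator on an invariant finite-dimensional subspace \<open>V\<close>. The trace does not depend on
  the chosen basis.\<close>

definition cscale :: "complex \<Rightarrow> ('a \<Rightarrow> complex) \<Rightarrow> 'a \<Rightarrow> complex" where
  "cscale c f = (\<lambda>x. c * f x)"

global_interpretation cfun: vector_space cscale
  by standard (auto simp: cscale_def fun_eq_iff algebra_simps)

definition is_basis :: "('a \<Rightarrow> complex) set \<Rightarrow> ('a \<Rightarrow> complex) set \<Rightarrow> bool" where
  "is_basis B V \<longleftrightarrow> cfun.independent B \<and> cfun.span B = V"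

definition trace_on ::
    "('a \<Rightarrow> complex) set \<Rightarrow> (('a \<Rightarrow> complex) \<Rightarrow> ('a \<Rightarrow> complex)) \<Rightarrow> complex" where
  "trace_on V f = (let B = (SOME B. is_basis B V) in \<Sum>b\<in>B. cfun.representation B (f b) b)"

text \<open>The irreducible character indexed by \<open>lam\<close> is the character of the Specht module, which
  is spanned by the polytabloids inside the permutation module on tabloids (James'
  convention: rows give tabloids, columns are antisymmetrised, so \<open>[n]\<close> is the trivial and
  \<open>replicate n 1\<close> the sign character).

  Only the values of a tableau on the diagram matter. A tabloid is the list of the row sets
  of a tableau; a function on lists of sets is a formal combination of tabloids.\<close>

definition diagram :: "nat list \<Rightarrow> (nat \<times> nat) set" where
  "diagram lam = {(i, j). i < length lam \<and> j < lam ! i}"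

definition is_tableau :: "nat list \<Rightarrow> (nat \<times> nat \<Rightarrow> nat) \<Rightarrow> bool" where
  "is_tableau lam t \<longleftrightarrow> bij_betw t (diagram lam) {1..sum_list lam}"

definition row_set :: "nat list \<Rightarrow> (nat \<times> nat \<Rightarrow> nat) \<Rightarrow> nat \<Rightarrow> nat set" where
  "row_set lam t i = {t (i, j) | j. (i, j) \<in> diagram lam}"

definition col_set :: "nat list \<Rightarrow> (nat \<times> nat \<Rightarrow> nat) \<Rightarrow> nat \<Rightarrow> nat set" where
  "col_set lam t j = {t (i, j) | i. (i, j) \<in> diagram lam}"

definition tabloid :: "nat list \<Rightarrow> (nat \<times> nat \<Rightarrow> nat) \<Rightarrow> nat set list" where
  "tabloid lam t = map (row_set lam t) [0..<length lam]"

definition col_stabilizer :: "nat list \<Rightarrow> (nat \<times> nat \<Rightarrow> nat) \<Rightarrow> (nat \<Rightarrow> nat) set" where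
  "col_stabilizer lam t =
     {\<pi>. \<pi> permutes {1..sum_list lam} \<and> (\<forall>j. \<pi> ` col_set lam t j = col_set lam t j)}"

definition polytabloid :: "nat list \<Rightarrow> (nat \<times> nat \<Rightarrow> nat) \<Rightarrow> nat set list \<Rightarrow> complex" where
  "polytabloid lam t = (\<lambda>T. \<Sum>\<pi>\<in>col_stabilizer lam t.
     of_int (sign \<pi>) * (if T = tabloid lam (\<pi> \<circ> t) then 1 else 0))"

definition specht :: "nat list \<Rightarrow> (nat set list \<Rightarrow> complex) set" where
  "specht lam = cfun.span {polytabloid lam t | t. is_tableau lam t}"

text \<open>The linear extension of \<open>T \<mapsto> s T\<close>; the inverse appears because
  formal combinations are represented by their coefficient functions.\<close>

definition perm_act ::
    "(nat \<Rightarrow> nat) \<Rightarrow> (nat set list \<Rightarrow> complex) \<Rightarrow> nat set list \<Rightarrow> complex" where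
  "perm_act s v = (\<lambda>T. v (map ((`) (inv s)) T))"

definition irr_char :: "nat list \<Rightarrow> (nat \<Rightarrow> nat) \<Rightarrow> complex" where
  "irr_char lam s = trace_on (specht lam) (perm_act s)"

definition derangements :: "nat \<Rightarrow> (nat \<Rightarrow> nat) set" where
  "derangements n = {s. s permutes {1..n} \<and> (\<forall>i\<in>{1..n}. s i \<noteq> i)}"

definition eta :: "nat list \<Rightarrow> complex" where
  "eta lam = (\<Sum>s\<in>derangements (sum_list lam). irr_char lam s) / irr_char lam id"

end

theory Submission
  imports Defs
begin

text \<open>
  Let \<open>\<kappa>\<close> be the column antisymmetriser of a tableau \<open>t\<close>. The sum \<open>z\<close> of all derangements is central, and it
  sends the polytabloid \<open>\<kappa>{t}\<close> to \<open>\<kappa>z{t}\<close>. Write \<open>z\<close> by inclusion-exclusion as an alternating sum of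
  the sums of the groups \<open>Sym(B)\<close> over sets \<open>B\<close> of entries. If \<open>B\<close> has two entries in one column, \<open>\<kappa>\<close> kills
  \<open>Sym(B)\<close>; otherwise only the elements of \<open>Sym(B)\<close> that preserve rows survive, and each acts as the
  identity on \<open>{t}\<close>. Hence \<open>z\<close> acts as the scalar \<open>\<eta> = (\<Sum>B. (-1)^(n-|B|) * \<Prod>i. |B \<inter> row i|!)\<close>, the sum running
  over the sets \<open>B\<close> of cells with at most one cell in each column.

  In terms of independent exponential variables \<open>x\<^sub>0, x\<^sub>1, \<dots>\<close>, up to sign this is the expectation of
  \<open>\<Prod>j. (x\<^sub>0 + \<dots> + x\<^bsub>c j - 1\<^esub> - 1)\<close> with \<open>c j\<close> the height of column \<open>j\<close>. Absorbing \<open>-1\<close> into \<open>x\<^sub>0\<close> makes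
  everything nonnegative, because the moments of \<open>x\<^sub>0 - 1\<close> are the derangement numbers. Log-convexity of the
  factorial then shows that moving a cell from a column of height \<open>a\<close> to one of height \<open>b \<le> a - 2\<close>
  does not decrease the expectation, and strictly increases it unless there is exactly one further
  column and it has height 1. Such moves lead from the columns of \<open>lam\<close> to those of \<open>lam'\<close>.
\<close>

section \<open>Sums over choices of one row per column\<close>

definition bump :: "nat \<Rightarrow> (nat \<Rightarrow> nat) \<Rightarrow> nat \<Rightarrow> nat" where
  "bump i \<mu> = \<mu>(i := Suc (\<mu> i))"

lemma bump_commute: "bump i (bump j \<mu>) = bump j (bump i \<mu>)"
  by (auto simp: bump_def fun_eq_iff)

text \<open>For independent exponential variables and \<open>w \<mu>\<close> the expectation of \<open>\<Prod>i. x\<^sub>i ^ \<mu> i\<close>, these are the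
  expectations of \<open>\<Prod>c\<in>cs. (x\<^sub>0 + \<dots> + x\<^bsub>c - 1\<^esub>)\<close> and \<open>\<Prod>c\<in>cs. (x\<^sub>0 + \<dots> + x\<^bsub>c - 1\<^esub> - 1)\<close>, each times
  the monomial with exponents \<open>\<mu>\<close>.\<close>

primrec choice_sum :: "((nat \<Rightarrow> nat) \<Rightarrow> real) \<Rightarrow> nat list \<Rightarrow> (nat \<Rightarrow> nat) \<Rightarrow> real" where
  "choice_sum w [] \<mu> = w \<mu>"
| "choice_sum w (c # cs) \<mu> = (\<Sum>i<c. choice_sum w cs (bump i \<mu>))"

primrec partial_choice_sum :: "((nat \<Rightarrow> nat) \<Rightarrow> real) \<Rightarrow> nat list \<Rightarrow> (nat \<Rightarrow> nat) \<Rightarrow> real" where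
  "partial_choice_sum w [] \<mu> = w \<mu>"
| "partial_choice_sum w (c # cs) \<mu> =
     (\<Sum>i<c. partial_choice_sum w cs (bump i \<mu>)) - partial_choice_sum w cs \<mu>"

text \<open>Bumps commute, so finite sums can be exchanged. This is the commutativity of the product
  of the column sums.\<close>

lemma choice_sum_move: "choice_sum w (xs @ c # ys) \<mu> = choice_sum w (c # xs @ ys) \<mu>"
proof (induction xs arbitrary: \<mu>)
  case (Cons x xs)
  have "choice_sum w ((x # xs) @ c # ys) \<mu> =
      (\<Sum>i<x. \<Sum>j<c. choice_sum w (xs @ ys) (bump j (bump i \<mu>)))"
    using Cons by simp
  also have "\<dots> = (\<Sum>j<c. \<Sum>i<x. choice_sum w (xs @ ys) (bump i (bump j \<mu>)))"
    by (subst sum.swap) (simp add: bump_commute)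
  finally show ?case by simp
qed simp

lemma choice_sum_mset_cong: "mset xs = mset ys \<Longrightarrow> choice_sum w xs \<mu> = choice_sum w ys \<mu>"
proof (induction xs arbitrary: ys \<mu>)
  case (Cons x xs)
  then have "x \<in> set ys" by (metis list.set_intros(1) set_mset_mset)
  then obtain as bs where ys: "ys = as @ x # bs" by (meson split_list)
  then have "mset xs = mset (as @ bs)" using Cons.prems by simp
  then show ?case unfolding ys choice_sum_move choice_sum.simps by (metis Cons.IH)
qed simp

text \<open>The recursion is linear in \<open>w\<close> and commutes with bumps. A factor
  \<open>x_j - 1\<close> can therefore be passed from the monomial to the weight.\<close>

lemma partial_choice_sum_diff:
  "partial_choice_sum w cs (bump j \<mu>) - partial_choice_sum w cs \<mu> =
   partial_choice_sum (\<lambda>\<nu>. w (bump j \<nu>) - w \<nu>) cs \<mu>"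
proof (induction cs arbitrary: \<mu>)
  case (Cons c cs)
  show ?case
    unfolding partial_choice_sum.simps Cons.IH[symmetric]
    by (simp add: sum_subtractf bump_commute[of _ j])
qed simp

section \<open>Moments of an exponential variable and derangement numbers\<close>

text \<open>\<open>shifted_fact p k\<close> is the expectation of \<open>x ^ p * (x - 1) ^ k\<close> for an exponential variable \<open>x\<close>;
  \<open>shifted_fact_Suc_left\<close> is integration by parts, and \<open>shifted_fact 0 k\<close> is the number of derangements
  of \<open>k\<close> points.\<close>

fun shifted_fact :: "nat \<Rightarrow> nat \<Rightarrow> real" where
  "shifted_fact p 0 = fact p"
| "shifted_fact p (Suc k) = shifted_fact (Suc p) k - shifted_fact p k"

lemma shifted_fact_Suc_left:
  "shifted_fact (Suc p) k = (p + 1) * shifted_fact p k + k * shifted_fact (Suc p) (k - 1)"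
proof (induction k arbitrary: p)
  case (Suc k)
  show ?case
  \<comment> \<open>The truncated \<open>k - 1\<close> forces the split; for
    \<open>k = Suc l\<close> the last bracket below folds back to
    \<open>shifted_fact (Suc p) k\<close>.\<close>
  proof (cases k)
    case 0
    then show ?thesis by (simp add: algebra_simps)
  next
    case (Suc l)
    have "shifted_fact (Suc p) (Suc k) = shifted_fact (Suc (Suc p)) k - shifted_fact (Suc p) k" by simp
    also have "\<dots> = ((p + 2) * shifted_fact (Suc p) k + k * shifted_fact (Suc (Suc p)) (k - 1))
        - ((p + 1) * shifted_fact p k + k * shifted_fact (Suc p) (k - 1))"
      using Suc.IH[of p] Suc.IH[of "Suc p"] by simp
    also have "\<dots> = (p + 1) * shifted_fact p (Suc k) + shifted_fact (Suc p) k
        + k * (shifted_fact (Suc (Suc p)) l - shifted_fact (Suc p) l)"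
      by (simp add: Suc algebra_simps)
    finally show ?thesis by (simp add: Suc algebra_simps)
  qed
qed simp

text \<open>The derangement recurrence: integration by parts at \<open>p = 0\<close>, where
  \<open>shifted_fact 1 k = shifted_fact 0 (Suc k) + shifted_fact 0 k\<close>.\<close>

lemma shifted_fact_rec: "shifted_fact 0 (Suc (Suc k)) = (k + 1) * (shifted_fact 0 (Suc k) + shifted_fact 0 k)"
  using shifted_fact_Suc_left[of 0 "Suc k"] by (simp add: algebra_simps)

lemma shifted_fact_nonneg: "0 \<le> shifted_fact 0 k"
proof (induction k rule: less_induct)
  case (less k)
  consider "k = 0" | "k = 1" | l where "k = Suc (Suc l)" by (metis One_nat_def not0_implies_Suc)
  then show ?case
  proof cases
    case (3 l)
    have "0 \<le> shifted_fact 0 (Suc l) + shifted_fact 0 l"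
      by (intro add_nonneg_nonneg less) (auto simp: 3)
    then show ?thesis unfolding 3 shifted_fact_rec by (intro mult_nonneg_nonneg) auto
  qed auto
qed

text \<open>At \<open>k = 1\<close> the value is 0, as one point has no derangement; this zero
  causes the exceptional case of the theorem. Of two consecutive indices one differs from 1, so the
  recurrence propagates positivity.\<close>

lemma shifted_fact_pos: "k \<noteq> 1 \<Longrightarrow> 0 < shifted_fact 0 k"
proof (induction k rule: less_induct)
  case (less k)
  consider "k = 0" | l where "k = Suc (Suc l)" using less.prems by (metis One_nat_def not0_implies_Suc)
  then show ?case
  proof cases
    case 2
    have "0 < shifted_fact 0 (Suc l) + shifted_fact 0 l"
    proof (cases "l = 1")
      case True
      then have "0 < shifted_fact 0 (Suc l)" using less 2 by auto
      then show ?thesis using shifted_fact_nonneg[of l] by linarith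
    next
      case False
      then have "0 < shifted_fact 0 l" using less 2 by auto
      then show ?thesis using shifted_fact_nonneg[of "Suc l"] by linarith
    qed
    then show ?thesis unfolding 2 shifted_fact_rec by (intro mult_pos_pos) auto
  qed simp
qed

section \<open>Absorbing the constant -1 into row 0\<close>

definition fact_weight :: "nat \<Rightarrow> (nat \<Rightarrow> nat) \<Rightarrow> real" where
  "fact_weight N \<mu> = (\<Prod>i<N. fact (\<mu> i))"

text \<open>Here \<open>\<mu> 0\<close> is the exponent of \<open>x\<^sub>0 - 1\<close> instead of \<open>x\<^sub>0\<close>.\<close>

definition derange_weight :: "nat \<Rightarrow> (nat \<Rightarrow> nat) \<Rightarrow> real" where
  "derange_weight N \<mu> = shifted_fact 0 (\<mu> 0) * (\<Prod>i\<in>{1..<N}. fact (\<mu> i))"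

text \<open>A column of height at least 1 contributes \<open>(x_0 - 1) + x_1 + ...\<close>. Here
  \<open>k\<close> counts the factors \<open>x_0 - 1\<close> chosen so far; plain powers of
  \<open>x_0\<close> never arise, so \<open>\<mu> 0 = 0\<close> persists in the induction.\<close>

lemma partial_choice_sum_eq_aux:
  assumes "\<forall>c\<in>set cs. 1 \<le> c" "\<mu> 0 = 0"
  shows "partial_choice_sum (\<lambda>\<nu>. shifted_fact (\<nu> 0) k * (\<Prod>i\<in>{1..<N}. fact (\<nu> i))) cs \<mu> =
    choice_sum (derange_weight N) cs (\<mu>(0 := k))"
  using assms
proof (induction cs arbitrary: \<mu> k)
  case Nil
  then show ?case by (simp add: derange_weight_def)
next
  case (Cons c cs)
  let ?w = "\<lambda>k \<nu>. shifted_fact (\<nu> 0) k * (\<Prod>i\<in>{1..<N}. fact (\<nu> i))"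
  have c: "{..<c} = insert 0 {1..<c}" using Cons.prems by auto
  have bump0: "bump 0 (\<mu>(0 := k)) = \<mu>(0 := Suc k)" by (simp add: bump_def)
  \<comment> \<open>One more factor \<open>x_0 - 1\<close> is the defining recursion of
    \<open>shifted_fact\<close>.\<close>
  have *: "(\<lambda>\<nu>. ?w k (bump 0 \<nu>) - ?w k \<nu>) = ?w (Suc k)"
    by (auto simp: fun_eq_iff bump_def algebra_simps intro!: prod.cong)
  have "partial_choice_sum (?w k) (c # cs) \<mu> =
     (\<Sum>i\<in>{1..<c}. partial_choice_sum (?w k) cs (bump i \<mu>)) +
     (partial_choice_sum (?w k) cs (bump 0 \<mu>) - partial_choice_sum (?w k) cs \<mu>)"
    by (simp add: c)
  also have "\<dots> = (\<Sum>i\<in>{1..<c}. partial_choice_sum (?w k) cs (bump i \<mu>)) +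
     partial_choice_sum (?w (Suc k)) cs \<mu>"
    by (simp only: partial_choice_sum_diff *)
  also have "partial_choice_sum (?w (Suc k)) cs \<mu> = choice_sum (derange_weight N) cs (\<mu>(0 := Suc k))"
    using Cons.IH[of \<mu> "Suc k"] Cons.prems
    by (simp del: shifted_fact.simps fun_upd_apply)
  also have "(\<Sum>i\<in>{1..<c}. partial_choice_sum (?w k) cs (bump i \<mu>)) =
      (\<Sum>i\<in>{1..<c}. choice_sum (derange_weight N) cs (bump i (\<mu>(0 := k))))"
  proof (intro sum.cong refl)
    fix i assume i: "i \<in> {1..<c}"
    have "bump i (\<mu>(0 := k)) = (bump i \<mu>)(0 := k)" using i by (auto simp: bump_def fun_eq_iff)
    then show "partial_choice_sum (?w k) cs (bump i \<mu>) = choice_sum (derange_weight N) cs (bump i (\<mu>(0 := k)))"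
      using Cons.IH[of "bump i \<mu>" k] Cons.prems i by (simp del: fun_upd_apply add: fun_upd_other) (simp add: bump_def)
  qed
  finally show ?case
    using bump0 unfolding choice_sum.simps by (simp only: c) (simp del: fun_upd_apply)
qed

text \<open>The case \<open>k = 0\<close>. It turns a signed sum into one with nonnegative terms
  only.\<close>

lemma partial_choice_sum_eq:
  assumes "\<forall>c\<in>set cs. 1 \<le> c" "1 \<le> N"
  shows "partial_choice_sum (fact_weight N) cs (\<lambda>_. 0) = choice_sum (derange_weight N) cs (\<lambda>_. 0)"
proof -
  have "{..<N} = insert 0 {1..<N}" using assms by auto
  then have "fact_weight N = (\<lambda>\<nu>. shifted_fact (\<nu> 0) 0 * (\<Prod>i\<in>{1..<N}. fact (\<nu> i)))"
    unfolding fact_weight_def by simp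
  moreover have "(\<lambda>_. 0)(0 := 0) = (\<lambda>_::nat. 0::nat)" by auto
  ultimately show ?thesis using partial_choice_sum_eq_aux[of cs "\<lambda>_. 0" 0 N] assms by simp
qed

section \<open>Positivity and monotonicity of the choice sums\<close>

lemma choice_sum_nonneg: "0 \<le> choice_sum (derange_weight N) cs \<mu>"
  by (induction cs arbitrary: \<mu>)
    (auto simp: derange_weight_def intro!: sum_nonneg mult_nonneg_nonneg shifted_fact_nonneg prod_nonneg)

text \<open>The term that chooses row 0 in every column suffices: its exponent in row 0 is
  \<open>\<mu> 0 + length cs\<close>, and only the exponent 1 has weight zero.\<close>

lemma choice_sum_pos:
  assumes "\<forall>c\<in>set cs. 1 \<le> c" "\<mu> 0 + length cs \<noteq> 1"
  shows "0 < choice_sum (derange_weight N) cs \<mu>"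
  using assms
proof (induction cs arbitrary: \<mu>)
  case Nil
  then show ?case by (auto simp: derange_weight_def intro!: mult_pos_pos shifted_fact_pos prod_pos)
next
  case (Cons c cs)
  have "0 < choice_sum (derange_weight N) cs (bump 0 \<mu>)"
    using Cons by (auto simp: bump_def)
  also have "\<dots> \<le> choice_sum (derange_weight N) (c # cs) \<mu>"
    unfolding choice_sum.simps using Cons.prems
    by (intro member_le_sum) (auto simp: choice_sum_nonneg)
  finally show ?case .
qed

text \<open>Log-convexity of the factorial: for a fixed sum, the more spread pair has the larger
  product.\<close>

lemma fact_mult_le:
  assumes "u + v = u' + v'" "u' \<le> u" "v' \<le> u"
  shows "fact u' * fact v' \<le> (fact u * fact v :: real)"
proof -
  have *: "fact (a + d) * fact b \<le> (fact (b + d) * fact a :: real)" if "a \<le> b" for a b d :: nat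
  proof (induction d)
    case (Suc d)
    have "fact (a + Suc d) * fact b = real (a + d + 1) * (fact (a + d) * fact b)" by (simp add: algebra_simps)
    also have "\<dots> \<le> real (b + d + 1) * (fact (b + d) * fact a)"
      using that by (intro mult_mono Suc) auto
    also have "\<dots> = fact (b + Suc d) * fact a" by (simp add: algebra_simps)
    finally show ?case .
  qed simp
  have "v \<le> v'" "u' = v + (u - v')" "u = v' + (u - v')" using assms by auto
  then show ?thesis using *[of v v' "u - v'"] by (simp add: mult.commute)
qed

text \<open>Every column that reaches row \<open>q\<close> also reaches the higher row
  \<open>p\<close>, so concentrating the exponents on \<open>p\<close> pays off. With
  \<open>1 \<le> p\<close>, row 0 and its derangement numbers, which are not log-convex, stay out of
  the comparison.\<close>

lemma choice_sum_mono:
  assumes "1 \<le> p" "p < q" "q < N" "\<And>i. i \<noteq> p \<Longrightarrow> i \<noteq> q \<Longrightarrow> \<mu> i = \<nu> i"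
    "\<mu> p + \<mu> q = \<nu> p + \<nu> q" "\<nu> p \<le> \<mu> p" "\<nu> q \<le> \<mu> p"
  shows "choice_sum (derange_weight N) cs \<nu> \<le> choice_sum (derange_weight N) cs \<mu>"
  using assms(4-)
proof (induction cs arbitrary: \<mu> \<nu>)
  case Nil
  have *: "{1..<N} = insert p (insert q ({1..<N} - {p, q}))" using assms by auto
  have "(\<Prod>i\<in>{1..<N}. fact (\<nu> i)) = fact (\<nu> p) * fact (\<nu> q) * (\<Prod>i\<in>{1..<N} - {p, q}. fact (\<nu> i))"
    using assms by (subst *) (simp add: mult.assoc)
  also have "\<dots> \<le> fact (\<mu> p) * fact (\<mu> q) * (\<Prod>i\<in>{1..<N} - {p, q}. fact (\<nu> i) :: real)"
    using Nil by (intro mult_right_mono fact_mult_le) (auto intro!: prod_nonneg)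
  also have "(\<Prod>i\<in>{1..<N} - {p, q}. fact (\<nu> i) :: real) = (\<Prod>i\<in>{1..<N} - {p, q}. fact (\<mu> i))"
    using Nil by (intro prod.cong) auto
  also have "fact (\<mu> p) * fact (\<mu> q) * \<dots> = (\<Prod>i\<in>{1..<N}. fact (\<mu> i))"
    using assms by (subst *) (simp add: mult.assoc)
  finally show ?case
    using Nil(1)[of 0] assms(1,2) shifted_fact_nonneg by (auto simp: derange_weight_def intro!: mult_left_mono)
next
  case (Cons c cs)
  let ?S = "choice_sum (derange_weight N) cs"
  have *: "?S (bump i \<nu>) \<le> ?S (bump i \<mu>)" if "i \<noteq> q" for i
    using Cons.prems assms(2) that by (intro Cons.IH) (auto simp: bump_def)
  show ?case
  proof (cases "q < c")
    case False
    then show ?thesis by (auto intro!: sum_mono *)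
  next
    case True
    have c: "{..<c} = insert p (insert q ({..<c} - {p, q}))" using True assms by auto
    have split: "choice_sum (derange_weight N) (c # cs) \<kappa> =
        ?S (bump p \<kappa>) + ?S (bump q \<kappa>) + (\<Sum>i\<in>{..<c} - {p, q}. ?S (bump i \<kappa>))" for \<kappa>
      unfolding choice_sum.simps using assms by (subst c) (simp add: add.assoc)
    have "?S (bump p \<nu>) + ?S (bump q \<nu>) \<le> ?S (bump p \<mu>) + ?S (bump q \<mu>)"
    \<comment> \<open>Bumping row \<open>q\<close> on both sides can violate
      \<open>\<nu> q \<le> \<mu> p\<close> only if \<open>\<nu>\<close> is \<open>\<mu>\<close> with
      rows \<open>p\<close> and \<open>q\<close> exchanged. Then the two bumps are compared
      crosswise.\<close>
    proof (cases "\<nu> q < \<mu> p")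
      case True
      then have "?S (bump q \<nu>) \<le> ?S (bump q \<mu>)"
        using Cons.prems assms(2) by (intro Cons.IH) (auto simp: bump_def)
      then show ?thesis using *[of p] assms by simp
    next
      case False
      then have eq: "\<nu> q = \<mu> p" "\<nu> p = \<mu> q" using Cons.prems by auto
      show ?thesis
      proof (cases "\<mu> p = \<mu> q")
        case True
        have "\<nu> i = \<mu> i" for i
          using Cons.prems(1)[of i] True eq by metis
        then have "\<nu> = \<mu>" by auto
        then show ?thesis by simp
      next
        case False
        have "?S (bump q \<nu>) \<le> ?S (bump p \<mu>)"
          using Cons.prems assms(2) eq
          by (intro Cons.IH) (simp_all add: bump_def)
        moreover have "?S (bump p \<nu>) \<le> ?S (bump q \<mu>)"
          using Cons.prems assms(2) eq False
          by (intro Cons.IH) (simp_all add: bump_def)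
        ultimately show ?thesis by simp
      qed
    qed
    moreover have "(\<Sum>i\<in>{..<c} - {p, q}. ?S (bump i \<nu>)) \<le> (\<Sum>i\<in>{..<c} - {p, q}. ?S (bump i \<mu>))"
      by (intro sum_mono *) auto
    ultimately show ?thesis unfolding split by linarith
  qed
qed

section \<open>Balancing the columns\<close>

text \<open>With \<open>S_k = x_0 + ... + x_(k-1)\<close>, the move changes the product of the two
  column sums by \<open>S_q x_b - x_q S_b\<close>. For \<open>k < b\<close> the term
  \<open>x_k x_b\<close> outweighs \<open>x_k x_q\<close> by monotonicity; among the remaining terms
  of \<open>S_q x_b\<close> is \<open>x_b\<close> squared, which is kept as the gain.\<close>

lemma choice_sum_balance:
  assumes "1 \<le> b" "b < q" "q < N"
  shows "choice_sum (derange_weight N) (Suc q # b # cs) (\<lambda>_. 0)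
      + choice_sum (derange_weight N) cs (bump b (bump b (\<lambda>_. 0)))
    \<le> choice_sum (derange_weight N) (q # Suc b # cs) (\<lambda>_. 0)"
proof -
  let ?S = "choice_sum (derange_weight N) cs" and ?z = "\<lambda>_. 0 :: nat"
  have "(\<Sum>k<b. ?S (bump k (bump q ?z))) \<le> (\<Sum>k<b. ?S (bump b (bump k ?z)))"
    using assms by (intro sum_mono choice_sum_mono) (auto simp: bump_def)
  moreover have "?S (bump b (bump b ?z)) \<le> (\<Sum>i\<in>{b..<q}. ?S (bump b (bump i ?z)))"
    using assms by (intro member_le_sum) (auto simp: choice_sum_nonneg)
  moreover have "(\<Sum>i<q. ?S (bump b (bump i ?z))) =
      (\<Sum>i<b. ?S (bump b (bump i ?z))) + (\<Sum>i\<in>{b..<q}. ?S (bump b (bump i ?z)))"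
    using assms by (subst sum.union_disjoint[symmetric]) (auto intro!: sum.cong)
  ultimately show ?thesis by (simp add: sum.distrib)
qed

text \<open>Balancing moves carry \<open>c\<close> to \<open>c'\<close>, and strictness comes from
  the gain of the last one. That gain vanishes if the only further column has height 1, hence the
  exclusion.\<close>

lemma choice_sum_dominance:
  fixes c c' :: "nat \<Rightarrow> nat" and m N :: nat
  defines "F \<equiv> \<lambda>d. choice_sum (derange_weight N) (map d [0..<m]) (\<lambda>_. 0)"
  assumes "\<And>j. j < m \<Longrightarrow> 1 \<le> c j" "\<And>j. j < m \<Longrightarrow> c j \<le> N"
    and "\<And>j. j < m \<Longrightarrow> 1 \<le> c' j" "\<And>j. j < m \<Longrightarrow> c' j \<le> N"
    and "\<And>i j. i \<le> j \<Longrightarrow> j < m \<Longrightarrow> c' j \<le> c' i"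
    and "\<And>k. k \<le> m \<Longrightarrow> (\<Sum>j<k. c' j) \<le> (\<Sum>j<k. c j)"
    and "(\<Sum>j<m. c' j) = (\<Sum>j<m. c j)"
  shows "F c \<le> F c' \<and> ((\<exists>j<m. c j \<noteq> c' j) \<and> \<not> (m = 3 \<and> c' 2 = 1) \<longrightarrow> F c < F c')"
  using assms(2-)
proof (induction "\<Sum>j<m. (c j - c' j) + (c' j - c j)" arbitrary: c rule: less_induct)
  case less
  note c = less.prems(1,2) and c' = less.prems(3-5) and dom = less.prems(6)
  show ?case
  proof (cases "\<exists>j<m. c j < c' j")
    case False
    then have le: "c' j \<le> c j" if "j < m" for j using that by force
    have "c j = c' j" if "j < m" for j
    proof (rule ccontr)
      assume "c j \<noteq> c' j"
      then have "c' j < c j" using le[OF that] by simp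
      then have "(\<Sum>j<m. c' j) < (\<Sum>j<m. c j)"
        using le that by (intro sum_strict_mono_ex1) auto
      then show False using less.prems(7) by simp
    qed
    then have "map c [0..<m] = map c' [0..<m]" "\<not> (\<exists>j<m. c j \<noteq> c' j)" by auto
    then show ?thesis unfolding F_def by (simp only: refl order_refl simp_thms)
  next
    case True
    \<comment> \<open>The first column that is still too low. Some earlier column has a surplus,
      since otherwise the prefix sum up to and including \<open>q\<close> would violate
      dominance.\<close>
    define q where "q = (LEAST j. j < m \<and> c j < c' j)"
    have q: "q < m" "c q < c' q" using LeastI_ex[OF True] by (auto simp: q_def)
    have below: "c' j \<le> c j" if "j < q" for j
      using not_less_Least[of j "\<lambda>j. j < m \<and> c j < c' j"] that q by (auto simp: q_def)
    have "\<exists>p<q. c' p < c p"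
    proof (rule ccontr)
      assume "\<not> ?thesis"
      then have "(\<Sum>j<q. c j) \<le> (\<Sum>j<q. c' j)" by (intro sum_mono) (meson leI lessThan_iff)
      moreover have "(\<Sum>j<Suc q. c' j) \<le> (\<Sum>j<Suc q. c j)" using q by (intro dom) auto
      ultimately show False using q by simp
    qed
    then obtain p where p: "p < q" "c' p < c p" by blast
    txt \<open>Only \<open>c'\<close> needs to be decreasing: \<open>c p > c' p \<ge> c' q > c q\<close> makes the move from \<open>p\<close> to \<open>q\<close> admissible,
      and the heights \<open>d\<close> may be in any order.\<close>
    define d where "d = c(p := c p - 1, q := Suc (c q))"
    have pm: "p < m" using p q by simp
    have gap: "c q < c p - 1" using p q c'(3)[of p q] by simp
    have pq: "{..<m} = insert p (insert q ({..<m} - {p, q}))" using pm q(1) by blast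
    \<comment> \<open>The columns that the move leaves alone; columns \<open>p\<close> and
      \<open>q\<close> are brought to the front.\<close>
    obtain xs where xs: "set xs = {..<m} - {p, q}" "distinct xs"
      using finite_distinct_list[of "{..<m} - {p, q}"] by blast
    have xsm: "x < m" if "x \<in> set xs" for x using that unfolding xs(1) by simp
    have perm: "mset [0..<m] = mset (p # q # xs)"
    proof -
      have "set [0..<m] = set (p # q # xs)"
        unfolding list.set(2) xs(1) pq[symmetric] by (simp add: atLeast0LessThan)
      moreover have "distinct (p # q # xs)" using xs p(1) by simp
      ultimately show ?thesis
        using set_eq_iff_mset_eq_distinct[OF distinct_upt, of "p # q # xs" 0 m] by blast
    qed
    have mset: "mset (map f [0..<m]) = mset (f p # f q # map f xs)" for f :: "nat \<Rightarrow> nat"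
      unfolding mset_map perm by simp
    have F: "F f = choice_sum (derange_weight N) (f p # f q # map f xs) (\<lambda>_. 0)" for f
      unfolding F_def by (rule choice_sum_mset_cong[OF mset])
    have dxs: "map d xs = map c xs" using xs by (auto simp: d_def)
    have step: "F c + choice_sum (derange_weight N) (map c xs) (bump (c q) (bump (c q) (\<lambda>_. 0))) \<le> F d"
    proof -
      have "Suc (c p - 1) = c p" using p by simp
      moreover have "d p = c p - 1" "d q = Suc (c q)" using p by (auto simp: d_def)
      moreover have "1 \<le> c q" "c p - 1 < N" using c(1)[OF q(1)] c(2)[OF pm] p by auto
      ultimately show ?thesis
        using choice_sum_balance[of "c q" "c p - 1" N "map c xs"] gap unfolding F dxs by simp
    qed
    have sums: "(\<Sum>j<k. d j) = (if k \<le> p \<or> q < k then \<Sum>j<k. c j else (\<Sum>j<k. c j) - 1)"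
      if "k \<le> m" for k
    proof -
      \<comment> \<open>Stated additively, because subtraction on \<open>nat\<close>
        truncates.\<close>
      have "(\<Sum>j<k. d j) + (if p < k then 1 else 0) = (\<Sum>j<k. c j) + (if q < k then 1 else 0)"
      proof (induction k)
        case (Suc k)
        show ?case using Suc p by (auto simp: d_def)
      qed simp
      then show ?thesis using p by (auto split: if_splits)
    qed
    have IH: "F d \<le> F c' \<and> ((\<exists>j<m. d j \<noteq> c' j) \<and> \<not> (m = 3 \<and> c' 2 = 1) \<longrightarrow> F d < F c')"
    proof (rule less.hyps)
      \<comment> \<open>The move lowers the distance to \<open>c'\<close> by 1 both at
        \<open>p\<close> and at \<open>q\<close>.\<close>
      show "(\<Sum>j<m. d j - c' j + (c' j - d j)) < (\<Sum>j<m. c j - c' j + (c' j - c j))"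
        using p q by (intro sum_strict_mono_ex1) (auto simp: d_def intro!: bexI[of _ p])
      show "1 \<le> d j" if "j < m" for j using c(1)[OF that] gap by (auto simp: d_def)
      show "d j \<le> N" if "j < m" for j using c(2)[OF that] c'(2)[OF q(1)] q c(2)[OF pm] by (auto simp: d_def)
      show "(\<Sum>j<k. c' j) \<le> (\<Sum>j<k. d j)" if "k \<le> m" for k
      proof (cases "k \<le> p \<or> q < k")
        case True
        then show ?thesis using sums[OF that] dom[OF that] by auto
      next
        case False
        \<comment> \<open>Before \<open>q\<close> no column of \<open>c\<close> is too low and
          column \<open>p\<close> has a surplus, so the inequality has room for the removed
          cell.\<close>
        then have "(\<Sum>j<k. c' j) < (\<Sum>j<k. c j)"
          using p below by (intro sum_strict_mono_ex1) auto
        then show ?thesis using False sums[OF that] by auto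
      qed
      show "(\<Sum>j<m. c' j) = (\<Sum>j<m. d j)" using sums[of m] q less.prems(7) by auto
    qed (use c' in auto)
    have nn: "0 \<le> choice_sum (derange_weight N) (map c xs) (bump (c q) (bump (c q) (\<lambda>_. 0)))"
      by (rule choice_sum_nonneg)
    have "F c < F c'" if ex: "\<not> (m = 3 \<and> c' 2 = 1)"
    proof (cases "\<exists>j<m. d j \<noteq> c' j")
      case True
      then have "F d < F c'" using IH ex by blast
      then show ?thesis using step nn by linarith
    next
      case False
      \<comment> \<open>Now \<open>d\<close> agrees with \<open>c'\<close>, so the move itself must
        be strict. The exponent of row 0 is 0, so the gain is clearly positive unless
        \<open>xs\<close> is a single column.\<close>
      have "0 < choice_sum (derange_weight N) (map c xs) (bump (c q) (bump (c q) (\<lambda>_. 0)))"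
      proof (cases "length xs = 1")
        case False
        show ?thesis
          using c(1)[OF q(1)] c(1) xsm False by (intro choice_sum_pos) (auto simp: bump_def)
      next
        case True
        then obtain x where x: "xs = [x]" by (auto simp: length_Suc_conv)
        have m: "m = 3"
        proof -
          have "card {..<m} = Suc (Suc (card ({..<m} - {p, q})))" using p by (subst pq) simp
          then show ?thesis using distinct_card[OF xs(2)] True unfolding xs(1) by simp
        qed
        have "x \<in> {..<m} - {p, q}" unfolding xs(1)[symmetric] x by simp
        then have xm: "x < m" "x \<noteq> p" "x \<noteq> q" by auto
        then have "c x = c' x" using False by (auto simp: d_def)
        moreover have "c' x \<noteq> 1" using ex m c'(3)[of x 2] c'(1)[of 2] xm by auto
        ultimately have "2 \<le> c x" using c(1)[OF xm(1)] by simp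
        \<comment> \<open>Row 1 is chosen in the single remaining column, which keeps the exponent
          of row 0 at 0; row 0 would give the exponent 1 of weight zero.\<close>
        have "0 < choice_sum (derange_weight N) [] (bump 1 (bump (c q) (bump (c q) (\<lambda>_. 0))))"
          using c(1)[OF q(1)] by (intro choice_sum_pos) (auto simp: bump_def)
        also have "\<dots> \<le> choice_sum (derange_weight N) (map c xs) (bump (c q) (bump (c q) (\<lambda>_. 0)))"
          unfolding x list.map choice_sum.simps(2) using \<open>2 \<le> c x\<close>
          by (intro member_le_sum[of 1]) (auto simp del: choice_sum.simps intro: choice_sum_nonneg)
        finally show ?thesis .
      qed
      then show ?thesis using IH step by linarith
    qed
    then show ?thesis using IH step nn by linarith
  qed
qed

section \<open>The action of the derangements on the Specht module\<close>

lemma row_set_comp: "row_set lam (s \<circ> t) i = s ` row_set lam t i"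
  by (auto simp: row_set_def)

lemma col_set_comp: "col_set lam (s \<circ> t) j = s ` col_set lam t j"
  by (auto simp: col_set_def)

lemma tabloid_comp: "tabloid lam (s \<circ> t) = map ((`) s) (tabloid lam t)"
  by (simp add: tabloid_def row_set_comp)

definition entry_pos :: "nat list \<Rightarrow> (nat \<times> nat \<Rightarrow> nat) \<Rightarrow> nat \<Rightarrow> nat \<times> nat" where
  "entry_pos lam t x = inv_into (diagram lam) t x"

abbreviation "entry_row lam t x \<equiv> fst (entry_pos lam t x)"
abbreviation "entry_col lam t x \<equiv> snd (entry_pos lam t x)"

lemma finite_diagram: "finite (diagram lam)"
  and card_diagram: "card (diagram lam) = sum_list lam"
proof -
  have d: "diagram lam = Sigma {..<length lam} (\<lambda>i. {..<lam ! i})" by (auto simp: diagram_def)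
  show "finite (diagram lam)" unfolding d by simp
  show "card (diagram lam) = sum_list lam"
    unfolding d by (simp add: sum_list_sum_nth atLeast0LessThan)
qed

lemma ex_tableau: "\<exists>t. is_tableau lam t"
  unfolding is_tableau_def
  by (rule finite_same_card_bij) (simp_all add: finite_diagram card_diagram)

context
  fixes lam :: "nat list" and t :: "nat \<times> nat \<Rightarrow> nat"
  assumes t: "is_tableau lam t"
begin

lemma bij_entry: "bij_betw t (diagram lam) {1..sum_list lam}"
  using t by (simp add: is_tableau_def)

lemma entry_pos_in: "x \<in> {1..sum_list lam} \<Longrightarrow> entry_pos lam t x \<in> diagram lam"
  unfolding entry_pos_def using bij_entry by (metis bij_betw_imp_surj_on inv_into_into)

lemma entry_pos_right: "x \<in> {1..sum_list lam} \<Longrightarrow> t (entry_pos lam t x) = x"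
  unfolding entry_pos_def using bij_entry by (metis bij_betw_imp_surj_on f_inv_into_f)

lemma entry_pos_left: "d \<in> diagram lam \<Longrightarrow> entry_pos lam t (t d) = d"
  unfolding entry_pos_def using bij_entry by (metis bij_betw_def inv_into_f_f)

lemma entry_in: "d \<in> diagram lam \<Longrightarrow> t d \<in> {1..sum_list lam}"
  using bij_entry by (meson bij_betwE)

lemma row_set_eq: "row_set lam t i = {x \<in> {1..sum_list lam}. entry_row lam t x = i}"
proof (intro set_eqI iffI)
  fix x assume "x \<in> row_set lam t i"
  then obtain j where "(i, j) \<in> diagram lam" "x = t (i, j)" by (auto simp: row_set_def)
  then show "x \<in> {x \<in> {1..sum_list lam}. entry_row lam t x = i}"
    using entry_in entry_pos_left by (metis (mono_tags, lifting) fst_conv mem_Collect_eq)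
next
  fix x assume x: "x \<in> {x \<in> {1..sum_list lam}. entry_row lam t x = i}"
  then have "entry_pos lam t x = (i, entry_col lam t x)" by (simp add: prod_eq_iff)
  then have "(i, entry_col lam t x) \<in> diagram lam" "t (i, entry_col lam t x) = x"
    using x entry_pos_in[of x] entry_pos_right[of x] by auto
  then show "x \<in> row_set lam t i" unfolding row_set_def by force
qed

lemma col_set_eq: "col_set lam t j = {x \<in> {1..sum_list lam}. entry_col lam t x = j}"
proof (intro set_eqI iffI)
  fix x assume "x \<in> col_set lam t j"
  then obtain i where "(i, j) \<in> diagram lam" "x = t (i, j)" by (auto simp: col_set_def)
  then show "x \<in> {x \<in> {1..sum_list lam}. entry_col lam t x = j}"
    using entry_in entry_pos_left by (metis (mono_tags, lifting) snd_conv mem_Collect_eq)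
next
  fix x assume x: "x \<in> {x \<in> {1..sum_list lam}. entry_col lam t x = j}"
  then have "entry_pos lam t x = (entry_row lam t x, j)" by (simp add: prod_eq_iff)
  then have "(entry_row lam t x, j) \<in> diagram lam" "t (entry_row lam t x, j) = x"
    using x entry_pos_in[of x] entry_pos_right[of x] by auto
  then show "x \<in> col_set lam t j" unfolding col_set_def by force
qed

lemma entry_pos_inj:
  "x \<in> {1..sum_list lam} \<Longrightarrow> y \<in> {1..sum_list lam} \<Longrightarrow> entry_pos lam t x = entry_pos lam t y \<Longrightarrow> x = y"
  using entry_pos_right by metis

lemma finite_col_stabilizer: "finite (col_stabilizer lam t)"
  by (rule finite_subset[OF _ finite_permutations[of "{1..sum_list lam}"]])
    (auto simp: col_stabilizer_def)

lemma col_stabilizer_comp: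
  "\<pi> \<in> col_stabilizer lam t \<Longrightarrow> \<rho> \<in> col_stabilizer lam t \<Longrightarrow> \<pi> \<circ> \<rho> \<in> col_stabilizer lam t"
  unfolding col_stabilizer_def by (auto simp: permutes_compose simp flip: image_image image_comp)

lemma transpose_col_stabilizer:
  assumes "x \<in> {1..sum_list lam}" "y \<in> {1..sum_list lam}" "entry_col lam t x = entry_col lam t y"
  shows "transpose x y \<in> col_stabilizer lam t"
proof -
  have "transpose x y ` col_set lam t j = col_set lam t j" for j
    using assms unfolding col_set_eq by (intro transpose_image_eq) auto
  then show ?thesis using assms by (simp add: col_stabilizer_def permutes_swap_id)
qed

section \<open>Cancellation under the column antisymmetriser\<close>

text \<open>\<open>\<kappa>\<^sub>t{u}\<close> in James' notation.\<close>

definition col_antisym :: "(nat \<times> nat \<Rightarrow> nat) \<Rightarrow> nat set list \<Rightarrow> complex" where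
  "col_antisym u T = (\<Sum>\<pi>\<in>col_stabilizer lam t.
     of_int (sign \<pi>) * (if T = tabloid lam (\<pi> \<circ> u) then 1 else 0))"

lemma polytabloid_eq: "polytabloid lam t = col_antisym t"
  by (simp add: polytabloid_def col_antisym_def fun_eq_iff)

lemma col_antisym_cong: "tabloid lam u = tabloid lam u' \<Longrightarrow> col_antisym u = col_antisym u'"
  by (simp add: col_antisym_def fun_eq_iff tabloid_comp)

text \<open>Right multiplication by the transposition permutes the column group and flips every
  sign.\<close>

lemma col_antisym_transpose:
  assumes "x \<in> {1..sum_list lam}" "y \<in> {1..sum_list lam}" "entry_col lam t x = entry_col lam t y" "x \<noteq> y"
  shows "col_antisym (transpose x y \<circ> u) T = - col_antisym u T"
proof -
  let ?\<tau> = "transpose x y"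
  note \<tau> = transpose_col_stabilizer[OF assms(1-3)]
  have perm: "permutation \<pi>" if "\<pi> \<in> col_stabilizer lam t" for \<pi>
    using that permutes_imp_permutation[of "{1..sum_list lam}" \<pi>] by (auto simp: col_stabilizer_def)
  have "col_antisym u T = (\<Sum>\<pi>\<in>col_stabilizer lam t.
     of_int (sign (\<pi> \<circ> ?\<tau>)) * (if T = tabloid lam ((\<pi> \<circ> ?\<tau>) \<circ> u) then 1 else 0))"
    unfolding col_antisym_def
    by (rule sum.reindex_bij_witness[of _ "\<lambda>\<pi>. \<pi> \<circ> ?\<tau>" "\<lambda>\<pi>. \<pi> \<circ> ?\<tau>"])
      (auto simp: \<tau> col_stabilizer_comp comp_assoc)
  also have "\<dots> = (\<Sum>\<pi>\<in>col_stabilizer lam t.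
     - (of_int (sign \<pi>) * (if T = tabloid lam (\<pi> \<circ> (?\<tau> \<circ> u)) then 1 else 0)))"
    using assms(4) perm by (intro sum.cong) (auto simp: sign_compose sign_swap_id permutation_swap_id comp_assoc)
  finally show ?thesis by (simp add: col_antisym_def sum_negf)
qed

lemma col_antisym_eq_0:
  assumes "x \<in> {1..sum_list lam}" "y \<in> {1..sum_list lam}" "entry_col lam t x = entry_col lam t y" "x \<noteq> y"
    and "tabloid lam (transpose x y \<circ> u) = tabloid lam u"
  shows "col_antisym u T = 0"
  using col_antisym_transpose[OF assms(1-4), of u T] col_antisym_cong[OF assms(5)] by simp

text \<open>Left multiplication by the transposition permutes the group on \<open>B\<close> but
  flips the sign of each term.\<close>

lemma sum_col_antisym_eq_0:
  assumes "x \<in> {1..sum_list lam}" "y \<in> {1..sum_list lam}" "entry_col lam t x = entry_col lam t y" "x \<noteq> y"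
    and "x \<in> B" "y \<in> B"
  shows "(\<Sum>s | s permutes B. col_antisym (s \<circ> t) T) = 0"
proof -
  let ?\<tau> = "transpose x y"
  have "?\<tau> permutes B" using assms by (simp add: permutes_swap_id)
  then have "(\<Sum>s | s permutes B. col_antisym (s \<circ> t) T) = (\<Sum>s | s permutes B. col_antisym (?\<tau> \<circ> (s \<circ> t)) T)"
    by (intro sum.reindex_bij_witness[of _ "\<lambda>\<pi>. ?\<tau> \<circ> \<pi>" "\<lambda>\<pi>. ?\<tau> \<circ> \<pi>"])
      (auto simp: permutes_compose simp flip: comp_assoc)
  also have "\<dots> = - (\<Sum>s | s permutes B. col_antisym (s \<circ> t) T)"
    by (simp add: col_antisym_transpose[OF assms(1-4)] sum_negf)
  finally show ?thesis by simp
qed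

text \<open>If \<open>s\<close> moves some entry \<open>z\<close> of \<open>B\<close> to a higher row, then the entry \<open>w\<close> of that row in the column
  of \<open>z\<close> is outside \<open>B\<close>, hence stays where it is, and the transposition of \<open>z\<close> and \<open>w\<close>
  cancels everything.\<close>

lemma col_antisym_transversal:
  assumes sorted: "sorted_wrt (\<ge>) lam" and B: "B \<subseteq> {1..sum_list lam}"
    and inj: "inj_on (entry_col lam t) B" and s: "s permutes B"
  shows "col_antisym (s \<circ> t) T =
    (if \<forall>x\<in>B. entry_row lam t (s x) = entry_row lam t x then polytabloid lam t T else 0)"
proof (cases "\<forall>x\<in>B. entry_row lam t (s x) = entry_row lam t x")
  case True
  have sN: "s permutes {1..sum_list lam}" using permutes_subset[OF s B] .
  have pres: "entry_row lam t (s x) = entry_row lam t x" for x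
    using True permutes_not_in[OF s] by metis
  have "s ` row_set lam t i = row_set lam t i" for i
  proof -
    have "s ` row_set lam t i \<subseteq> row_set lam t i"
      unfolding row_set_eq using pres permutes_in_image[OF sN] by auto
    moreover have "finite (row_set lam t i)" unfolding row_set_eq by simp
    ultimately show ?thesis
      using card_image[OF permutes_inj_on[OF s, of "row_set lam t i"]] by (metis card_subset_eq)
  qed
  then have "tabloid lam (s \<circ> t) = tabloid lam t" by (simp add: tabloid_def row_set_comp)
  then show ?thesis using True col_antisym_cong[of "s \<circ> t" t] by (simp add: polytabloid_eq)
next
  case False
  have "finite B" using B finite_subset by blast
  \<comment> \<open>Permuting \<open>B\<close> preserves the sum of its row indices, so they cannot
    only decrease.\<close>
  have "\<exists>x\<in>B. entry_row lam t x < entry_row lam t (s x)"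
  proof (rule ccontr)
    assume neg: "\<not> ?thesis"
    have "(\<Sum>x\<in>B. entry_row lam t (s x)) < (\<Sum>x\<in>B. entry_row lam t x)"
    proof (rule sum_strict_mono_ex1)
      show "\<forall>x\<in>B. entry_row lam t (s x) \<le> entry_row lam t x" using neg by (meson leI)
      then show "\<exists>x\<in>B. entry_row lam t (s x) < entry_row lam t x" using False by (meson le_neq_implies_less)
    qed fact
    moreover have "(\<Sum>x\<in>B. entry_row lam t (s x)) = (\<Sum>x\<in>B. entry_row lam t x)"
      using sum.permute[OF s, of "entry_row lam t"] by (simp add: comp_def)
    ultimately show False by simp
  qed
  then obtain x where x: "x \<in> B" "entry_row lam t x < entry_row lam t (s x)" by blast
  define z where "z = s x"
  define w where "w = t (entry_row lam t x, entry_col lam t z)"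
  have z: "z \<in> B" using x s by (simp add: z_def permutes_in_image)
  have zN: "z \<in> {1..sum_list lam}" and xN: "x \<in> {1..sum_list lam}" using z x B by auto
  have zd: "entry_row lam t z < length lam" "entry_col lam t z < lam ! entry_row lam t z"
    using entry_pos_in[OF zN] by (auto simp: diagram_def case_prod_beta)
  have d: "(entry_row lam t x, entry_col lam t z) \<in> diagram lam"
  proof -
    \<comment> \<open>The row of \<open>x\<close> lies above that of \<open>z\<close>, hence is at
      least as long and has a cell in the column of \<open>z\<close>.\<close>
    have "lam ! entry_row lam t z \<le> lam ! entry_row lam t x"
      using sorted x(2) zd by (simp add: sorted_wrt_iff_nth_less z_def)
    then show ?thesis using zd x(2) by (auto simp: diagram_def z_def)
  qed
  have wN: "w \<in> {1..sum_list lam}" unfolding w_def by (rule entry_in[OF d])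
  have wpos: "entry_row lam t w = entry_row lam t x" "entry_col lam t w = entry_col lam t z"
    unfolding w_def entry_pos_left[OF d] by simp_all
  have wz: "w \<noteq> z" using wpos(1) x(2) by (auto simp: z_def)
  have wB: "w \<notin> B" using inj wz wpos(2) z by (auto dest: inj_onD)
  have sw: "s w = w" using s wB by (simp add: permutes_not_in)
  \<comment> \<open>In the tabloid of \<open>s \<circ> t\<close>, both \<open>z = s x\<close> and
    \<open>w = s w\<close> lie in the row that \<open>x\<close> occupies in
    \<open>t\<close>.\<close>
  have "transpose z w ` s ` row_set lam t i = s ` row_set lam t i" for i
  proof (cases "i = entry_row lam t x")
    case True
    then have "x \<in> row_set lam t i" "w \<in> row_set lam t i" using xN wN wpos by (auto simp: row_set_eq)
    then have "s x \<in> s ` row_set lam t i" "s w \<in> s ` row_set lam t i" by blast+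
    then show ?thesis unfolding sw by (intro transpose_image_eq) (simp add: z_def)
  next
    case False
    have out: "s y \<notin> s ` row_set lam t i" if "entry_row lam t y = entry_row lam t x" for y
      using False that unfolding inj_image_mem_iff[OF permutes_inj[OF s]] row_set_eq by simp
    have "z \<notin> s ` row_set lam t i" "w \<notin> s ` row_set lam t i"
      using out[of x] out[of w] sw wpos(1) by (simp_all add: z_def)
    then show ?thesis by (intro transpose_image_eq) simp
  qed
  then have "tabloid lam (transpose z w \<circ> (s \<circ> t)) = tabloid lam (s \<circ> t)"
    by (simp add: tabloid_def row_set_comp)
  then show ?thesis unfolding if_not_P[OF False] using col_antisym_eq_0[OF zN wN] wpos wz by simp
qed

end

section \<open>Inclusion-exclusion and the scalar of the derangement sum\<close>

text \<open>The indicator of a derangement is the product of \<open>1 - [s x = x]\<close>. Expanding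
  it, \<open>B\<close> collects the points where 1 is chosen; all other points are fixed, so
  \<open>s\<close> permutes \<open>B\<close>.\<close>

lemma sum_derangements:
  fixes f :: "(nat \<Rightarrow> nat) \<Rightarrow> complex"
  shows "(\<Sum>s\<in>derangements n. f s) =
    (\<Sum>B\<in>Pow {1..n}. (-1) ^ card ({1..n} - B) * (\<Sum>s | s permutes B. f s))"
proof -
  let ?N = "{1..n}"
  let ?fix = "\<lambda>s x. if s x = x then 1 else 0 :: complex"
  have "(\<Sum>s\<in>derangements n. f s) = (\<Sum>s | s permutes ?N. if \<forall>x\<in>?N. s x \<noteq> x then f s else 0)"
    by (rule sum.mono_neutral_cong_left) (auto simp: derangements_def finite_permutations)
  also have "\<dots> = (\<Sum>s | s permutes ?N. (\<Prod>x\<in>?N. 1 + - ?fix s x) * f s)"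
    by (intro sum.cong refl) (auto intro!: prod.neutral)
  also have "\<dots> = (\<Sum>s | s permutes ?N. \<Sum>B\<in>Pow ?N. (\<Prod>x\<in>?N - B. - ?fix s x) * f s)"
    by (subst prod_add) (simp_all add: sum_distrib_right)
  also have "\<dots> = (\<Sum>B\<in>Pow ?N. \<Sum>s | s permutes ?N. (\<Prod>x\<in>?N - B. - ?fix s x) * f s)"
    by (rule sum.swap)
  also have "\<dots> = (\<Sum>B\<in>Pow ?N. (-1) ^ card (?N - B) * (\<Sum>s | s permutes B. f s))"
  proof (intro sum.cong refl)
    fix B assume B: "B \<in> Pow ?N"
    have "(\<Sum>s | s permutes B. (-1) ^ card (?N - B) * f s) =
        (\<Sum>s | s permutes ?N. (\<Prod>x\<in>?N - B. - ?fix s x) * f s)"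
    proof (rule sum.mono_neutral_cong_left)
      show "{s. s permutes B} \<subseteq> {s. s permutes ?N}" using B permutes_subset by auto
      show "\<forall>s\<in>{s. s permutes ?N} - {s. s permutes B}. (\<Prod>x\<in>?N - B. - ?fix s x) * f s = 0"
      proof
        fix s assume "s \<in> {s. s permutes ?N} - {s. s permutes B}"
        then have "\<exists>x\<in>?N - B. s x \<noteq> x" by (metis (no_types, lifting) DiffD1 DiffD2 mem_Collect_eq permutes_superset)
        then have "(\<Prod>x\<in>?N - B. - ?fix s x) = 0" by (intro prod_zero) auto
        then show "(\<Prod>x\<in>?N - B. - ?fix s x) * f s = 0" by simp
      qed
      fix s assume "s \<in> {s. s permutes B}"
      then have "(\<Prod>x\<in>?N - B. - ?fix s x) = (\<Prod>x\<in>?N - B. -1)"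
        by (intro prod.cong) (auto simp: permutes_not_in)
      then show "(-1) ^ card (?N - B) * f s = (\<Prod>x\<in>?N - B. - ?fix s x) * f s" by simp
    qed (auto simp: finite_permutations)
    then show "(\<Sum>s | s permutes ?N. (\<Prod>x\<in>?N - B. - ?fix s x) * f s) =
        (-1) ^ card (?N - B) * (\<Sum>s | s permutes B. f s)"
      by (simp add: sum_distrib_left)
  qed
  finally show ?thesis .
qed

text \<open>The order of a Young subgroup.\<close>

lemma card_fibre_permutations:
  fixes r :: "'a \<Rightarrow> nat"
  assumes "finite B" "r ` B \<subseteq> {..<L}"
  shows "card {s. s permutes B \<and> (\<forall>x\<in>B. r (s x) = r x)} = (\<Prod>i<L. fact (card {x \<in> B. r x = i}))"
  using assms
proof (induction B rule: finite_induct)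
  case empty
  then show ?case by simp
next
  case (insert a B)
  let ?P = "\<lambda>B. {s. s permutes B \<and> (\<forall>x\<in>B. r (s x) = r x)}"
  let ?C = "{b \<in> insert a B. r b = r a}"
  \<comment> \<open>A permutation of \<open>insert a B\<close> factors uniquely through
    \<open>b\<close>, the image of \<open>a\<close>; it preserves \<open>r\<close> exactly if
    \<open>r b = r a\<close> and \<open>s\<close> preserves \<open>r\<close>.\<close>
  have "bij_betw (\<lambda>(b, s). transpose a b \<circ> s) (?C \<times> ?P B) (?P (insert a B))"
  proof (rule bij_betw_imageI)
    show "inj_on (\<lambda>(b, s). transpose a b \<circ> s) (?C \<times> ?P B)"
    proof (rule inj_onI)
      fix u v
      assume "u \<in> ?C \<times> ?P B" "v \<in> ?C \<times> ?P B"
        and "(\<lambda>(b, s). transpose a b \<circ> s) u = (\<lambda>(b, s). transpose a b \<circ> s) v"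
      then obtain b s b' s' where uv: "u = (b, s)" "v = (b', s')" and s: "s permutes B" "s' permutes B"
        and eq: "transpose a b \<circ> s = transpose a b' \<circ> s'" by auto
      have "s a = a" "s' a = a" using s insert.hyps by (auto simp: permutes_not_in)
      then have b: "b = b'" using fun_cong[OF eq, of a] by simp
      have "s x = s' x" for x
        using fun_cong[OF eq, of x] b by (metis comp_apply transpose_involutory)
      then show "u = v" using b uv by auto
    qed
    show "(\<lambda>(b, s). transpose a b \<circ> s) ` (?C \<times> ?P B) = ?P (insert a B)"
    proof (intro set_eqI iffI)
      fix p assume "p \<in> (\<lambda>(b, s). transpose a b \<circ> s) ` (?C \<times> ?P B)"
      then obtain b s where b: "b \<in> insert a B" "r b = r a" and s: "s permutes B" "\<forall>x\<in>B. r (s x) = r x"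
        and p: "p = transpose a b \<circ> s" by auto
      have "p permutes insert a B" using permutes_insert[of a B] b s p by auto
      moreover have "r (s x) = r x" for x using s by (metis permutes_not_in)
      moreover have "r (p x) = r (s x)" for x using b unfolding p by (simp add: transpose_def)
      ultimately show "p \<in> ?P (insert a B)" by simp
    next
      fix p assume p: "p \<in> ?P (insert a B)"
      then have "p \<in> (\<lambda>(b, s). transpose a b \<circ> s) ` {(b, s). b \<in> insert a B \<and> s \<in> {s. s permutes B}}"
        using permutes_insert[of a B] by blast
      then obtain b s where b: "b \<in> insert a B" and s: "s permutes B" and ps: "p = transpose a b \<circ> s"
        by auto
      have "s a = a" using s insert.hyps by (simp add: permutes_not_in)
      then have "p a = b" using ps by simp
      then have rb: "r b = r a" using p by auto
      have "r (s x) = r x" if "x \<in> B" for x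
      proof -
        have "r (p x) = r x" using p that by simp
        then show ?thesis using rb unfolding ps by (auto simp: transpose_def split: if_splits)
      qed
      then show "p \<in> (\<lambda>(b, s). transpose a b \<circ> s) ` (?C \<times> ?P B)" using b rb s ps by force
    qed
  qed
  from bij_betw_same_card[OF this] have "card (?P (insert a B)) = card ?C * card (?P B)"
    by (simp only: card_cartesian_product)
  also have "card (?P B) = (\<Prod>i<L. fact (card {x \<in> B. r x = i}))" using insert.IH insert.prems by blast
  also have "card ?C = Suc (card {x \<in> B. r x = r a})"
  proof -
    have "?C = insert a {x \<in> B. r x = r a}" by auto
    then show ?thesis using insert.hyps by simp
  qed
  also have "Suc (card {x \<in> B. r x = r a}) * (\<Prod>i<L. fact (card {x \<in> B. r x = i})) =
      (\<Prod>i<L. fact (card {x \<in> insert a B. r x = i}))"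
  proof -
    have ra: "r a \<in> {..<L}" using insert.prems by auto
    have other: "{x \<in> insert a B. r x = i} = {x \<in> B. r x = i}" if "i \<noteq> r a" for i using that by auto
    have "{x \<in> insert a B. r x = r a} = insert a {x \<in> B. r x = r a}" by auto
    then have "card {x \<in> insert a B. r x = r a} = Suc (card {x \<in> B. r x = r a})"
      using insert.hyps by simp
    moreover have "(\<Prod>i\<in>{..<L} - {r a}. fact (card {x \<in> insert a B. r x = i}) :: nat) =
        (\<Prod>i\<in>{..<L} - {r a}. fact (card {x \<in> B. r x = i}))"
      by (rule prod.cong[OF refl], subst other) auto
    ultimately show ?thesis
      unfolding prod.remove[OF finite_lessThan ra] by (simp only: fact_Suc mult.assoc of_nat_id)
  qed
  finally show ?case .
qed

text \<open>The scalar by which the derangement sum acts, written with cells instead of entries so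
  that no tableau occurs.\<close>

definition transversal_sum :: "nat list \<Rightarrow> complex" where
  "transversal_sum lam = (\<Sum>B | B \<subseteq> diagram lam \<and> inj_on snd B.
     (-1) ^ card (diagram lam - B) * (\<Prod>i<length lam. fact (card {x \<in> B. fst x = i})))"

text \<open>Sets \<open>B\<close> with two entries in one column cancel; for the others each
  row-preserving permutation of \<open>B\<close> contributes one copy of the polytabloid.\<close>

lemma sum_col_antisym:
  assumes lam: "is_partition n lam" and t: "is_tableau lam t"
  shows "(\<Sum>s\<in>derangements n. col_antisym lam t (s \<circ> t) T) = transversal_sum lam * polytabloid lam t T"
proof -
  have n: "n = sum_list lam" and sorted: "sorted_wrt (\<ge>) lam" using lam by (auto simp: is_partition_def)
  let ?N = "{1..n}" and ?D = "diagram lam"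
  let ?f = "\<lambda>B. \<Sum>s | s permutes B. col_antisym lam t (s \<circ> t) T"
  let ?r = "entry_row lam t" and ?c = "entry_col lam t"
  have bij: "bij_betw t ?D ?N" using bij_entry[OF t] n by simp
  have f0: "?f B = 0" if "B \<subseteq> ?N" "\<not> inj_on ?c B" for B
  proof -
    obtain x y where "x \<in> B" "y \<in> B" "x \<noteq> y" "?c x = ?c y" using \<open>\<not> inj_on ?c B\<close> by (auto simp: inj_on_def)
    then show ?thesis using that n by (intro sum_col_antisym_eq_0[OF t, of x y]) auto
  qed
  have f1: "?f B = (\<Prod>i<length lam. fact (card {x \<in> B. ?r x = i})) * polytabloid lam t T"
    if B: "B \<subseteq> ?N" "inj_on ?c B" for B
  proof -
    have fin: "finite B" using B finite_subset by blast
    have "?f B = (\<Sum>s | s permutes B. if \<forall>x\<in>B. ?r (s x) = ?r x then polytabloid lam t T else 0)"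
      using B n by (intro sum.cong refl) (simp add: col_antisym_transversal[OF t sorted])
    also have "\<dots> = of_nat (card {s. s permutes B \<and> (\<forall>x\<in>B. ?r (s x) = ?r x)}) * polytabloid lam t T"
      using finite_permutations[OF fin] by (simp add: sum.If_cases Collect_conj_eq)
    also have "?r x < length lam" if "x \<in> B" for x
      using entry_pos_in[OF t, of x] that B n by (auto simp: diagram_def case_prod_beta)
    then have "card {s. s permutes B \<and> (\<forall>x\<in>B. ?r (s x) = ?r x)} = (\<Prod>i<length lam. fact (card {x \<in> B. ?r x = i}))"
      by (intro card_fibre_permutations fin) auto
    finally show ?thesis by (simp only: of_nat_prod of_nat_fact)
  qed
  have "(\<Sum>s\<in>derangements n. col_antisym lam t (s \<circ> t) T) = (\<Sum>B\<in>Pow ?N. (-1) ^ card (?N - B) * ?f B)"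
    by (rule sum_derangements)
  also have "\<dots> = (\<Sum>B | B \<subseteq> ?N \<and> inj_on ?c B. (-1) ^ card (?N - B) * ?f B)"
    by (rule sum.mono_neutral_right) (auto simp: f0)
  also have "\<dots> = (\<Sum>B | B \<subseteq> ?N \<and> inj_on ?c B.
      (-1) ^ card (?N - B) * (\<Prod>i<length lam. fact (card {x \<in> B. ?r x = i}))) * polytabloid lam t T"
    by (simp add: f1 sum_distrib_right mult.assoc)
  also have "(\<Sum>B | B \<subseteq> ?N \<and> inj_on ?c B.
      (-1) ^ card (?N - B) * (\<Prod>i<length lam. fact (card {x \<in> B. ?r x = i}))) = transversal_sum lam"
    unfolding transversal_sum_def
  \<comment> \<open>The tableau carries sets of cells to sets of entries.\<close>
  proof (rule sum.reindex_bij_witness[of _ "\<lambda>B. t ` B" "\<lambda>B. entry_pos lam t ` B"], goal_cases)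
    case (1 B)
    then show ?case using entry_pos_right[OF t] n by (force simp: image_image)
  next
    case (2 B)
    then have *: "B \<subseteq> ?N" by simp
    then have "entry_pos lam t ` B \<subseteq> ?D" using entry_pos_in[OF t] n by blast
    moreover have "inj_on (snd \<circ> entry_pos lam t) B" using 2 by (simp add: comp_def)
    ultimately show ?case using inj_on_imageI by blast
  next
    case (3 B)
    then show ?case using entry_pos_left[OF t] by (force simp: image_image)
  next
    case (4 B)
    then have B: "B \<subseteq> ?D" "inj_on snd B" by auto
    then have "t ` B \<subseteq> ?N" using bij by (auto simp: bij_betw_def)
    moreover have "inj_on ?c (t ` B)"
    proof (rule inj_onI, clarify)
      fix a b a' b' assume "(a, b) \<in> B" "(a', b') \<in> B" "?c (t (a, b)) = ?c (t (a', b'))"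
      moreover from this have "?c (t (a, b)) = b" "?c (t (a', b')) = b'"
        using B entry_pos_left[OF t] by auto
      ultimately show "t (a, b) = t (a', b')" using inj_onD[OF B(2), of "(a, b)" "(a', b')"] by simp
    qed
    ultimately show ?case by simp
  next
    case (5 B)
    then have B: "B \<subseteq> ?N" by simp
    have inj: "inj_on (entry_pos lam t) ?N" using entry_pos_inj[OF t] n by (auto intro!: inj_onI)
    have "?D = entry_pos lam t ` ?N"
    proof
      show "entry_pos lam t ` ?N \<subseteq> ?D" using entry_pos_in[OF t] n by auto
      show "?D \<subseteq> entry_pos lam t ` ?N"
      proof
        fix d assume "d \<in> ?D"
        then show "d \<in> entry_pos lam t ` ?N" using entry_pos_left[OF t] entry_in[OF t] n by (metis imageI)
      qed
    qed
    then have "?D - entry_pos lam t ` B = entry_pos lam t ` (?N - B)"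
      using inj_on_image_set_diff[OF inj _ B] by auto
    then have 1: "card (?D - entry_pos lam t ` B) = card (?N - B)"
      using card_image inj by (metis Diff_subset inj_on_subset)
    have 2: "card {x \<in> entry_pos lam t ` B. fst x = i} = card {x \<in> B. ?r x = i}" for i
    proof -
      have "{x \<in> entry_pos lam t ` B. fst x = i} = entry_pos lam t ` {x \<in> B. ?r x = i}" by auto
      moreover have "inj_on (entry_pos lam t) {x \<in> B. ?r x = i}"
        by (rule inj_on_subset[OF inj]) (use B in auto)
      ultimately show ?thesis by (simp add: card_image)
    qed
    show ?case unfolding 1 2 ..
  qed
  finally show ?thesis .
qed

section \<open>The derangement sum on the Specht module\<close>

lemma perm_act_add: "perm_act s (v + w) = perm_act s v + perm_act s w"
  by (simp add: perm_act_def fun_eq_iff)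

lemma perm_act_scale: "perm_act s (cscale c v) = cscale c (perm_act s v)"
  by (simp add: perm_act_def cscale_def)

lemma perm_act_0: "perm_act s 0 = 0"
  by (simp add: perm_act_def fun_eq_iff)

lemma perm_act_id: "perm_act id v = v"
  by (simp add: perm_act_def image_id[unfolded id_def] id_def)

lemma map_image_inv_eq_iff:
  assumes "bij s"
  shows "map ((`) (inv s)) T = U \<longleftrightarrow> T = map ((`) s) U"
proof
  have "s \<circ> inv s = id" using bij_is_surj[OF assms] surj_iff by blast
  moreover assume "map ((`) (inv s)) T = U"
  then have "map ((`) s) U = map ((`) (s \<circ> inv s)) T" by (auto simp: image_comp)
  ultimately show "T = map ((`) s) U" by simp
next
  assume "T = map ((`) s) U"
  then have "map ((`) (inv s)) T = map ((`) (inv s \<circ> s)) U" by (auto simp: image_comp)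
  then show "map ((`) (inv s)) T = U" using assms by (simp add: bij_is_inj map_idI)
qed

lemma perm_act_polytabloid:
  assumes "bij s"
  shows "perm_act s (polytabloid lam t) T =
    (\<Sum>\<pi>\<in>col_stabilizer lam t. of_int (sign \<pi>) * (if T = tabloid lam (s \<circ> \<pi> \<circ> t) then 1 else 0))"
  unfolding perm_act_def polytabloid_def map_image_inv_eq_iff[OF assms] comp_assoc
  by (simp add: tabloid_comp)

lemma conj_permutes:
  assumes "p permutes A" "s permutes A"
  shows "p \<circ> s \<circ> inv p permutes A"
  using assms by (intro permutes_compose permutes_inv)

lemma sign_conj:
  assumes "p permutes A" "s permutes A" "finite A"
  shows "sign (p \<circ> s \<circ> inv p) = sign s"
proof -
  have "permutation p" "permutation s" using assms permutes_imp_permutation by blast+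
  then show ?thesis
    by (simp add: sign_compose permutation_compose permutation_inverse sign_inverse)
qed

lemma col_stabilizer_conj:
  assumes "s permutes {1..sum_list lam}" "\<pi> \<in> col_stabilizer lam t"
  shows "s \<circ> \<pi> \<circ> inv s \<in> col_stabilizer lam (s \<circ> t)"
proof -
  have "(s \<circ> \<pi> \<circ> inv s) ` (s ` C) = s ` \<pi> ` C" for C
    using assms(1) by (auto simp: image_comp[symmetric] image_image permutes_inverses)
  then show ?thesis
    using assms conj_permutes[of s] by (auto simp: col_stabilizer_def col_set_comp)
qed

lemma is_tableau_comp:
  assumes "s permutes {1..sum_list lam}" "is_tableau lam t"
  shows "is_tableau lam (s \<circ> t)"
  using assms bij_betw_trans permutes_imp_bij unfolding is_tableau_def by blast

text \<open>Conjugation by \<open>s\<close> carries the column group of \<open>t\<close> to that of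
  \<open>s \<circ> t\<close> and preserves signs.\<close>

lemma perm_act_polytabloid_eq:
  assumes "s permutes {1..sum_list lam}"
  shows "perm_act s (polytabloid lam t) = polytabloid lam (s \<circ> t)"
proof
  fix T
  note s = permutes_bij[OF assms] and inv_s = permutes_inv[OF assms]
  have o: "inv s \<circ> s = id" "s \<circ> inv s = id" using permutes_inv_o[OF assms] by auto
  have t: "inv s \<circ> (s \<circ> t) = t" by (simp add: o flip: comp_assoc)
  have o': "s \<circ> (inv s \<circ> f) = f" "inv s \<circ> (s \<circ> f) = f" for f :: "nat \<Rightarrow> nat" by (simp_all add: o flip: comp_assoc)
  show "perm_act s (polytabloid lam t) T = polytabloid lam (s \<circ> t) T"
    unfolding perm_act_polytabloid[OF s] unfolding polytabloid_def
  proof (rule sum.reindex_bij_witness[of _ "\<lambda>\<pi>. inv s \<circ> \<pi> \<circ> s" "\<lambda>\<pi>. s \<circ> \<pi> \<circ> inv s"], goal_cases)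
    case (1 \<pi>) then show ?case by (simp add: comp_assoc o o')
  next
    case (2 \<pi>) then show ?case by (rule col_stabilizer_conj[OF assms])
  next
    case (3 \<pi>) then show ?case by (simp add: comp_assoc o o')
  next
    case (4 \<pi>)
    then show ?case using col_stabilizer_conj[OF inv_s, of \<pi> "s \<circ> t"] unfolding t
      by (simp add: permutes_inv_inv[OF assms])
  next
    case (5 \<pi>)
    then have "\<pi> permutes {1..sum_list lam}" by (simp add: col_stabilizer_def)
    then show ?case using sign_conj[OF assms, of \<pi>] by (simp add: comp_assoc t)
  qed
qed

lemma sum_fun_apply: "(\<Sum>i\<in>A. f i) x = (\<Sum>i\<in>A. f i x)" for f :: "'i \<Rightarrow> 'a \<Rightarrow> complex"
  by (induction A rule: infinite_finite_induct) auto

lemma derangement_conj: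
  assumes "p permutes {1..n}" "s \<in> derangements n"
  shows "p \<circ> s \<circ> inv p \<in> derangements n"
proof -
  have "p (s (inv p x)) \<noteq> x" if "x \<in> {1..n}" for x
  proof
    assume "p (s (inv p x)) = x"
    then have "s (inv p x) = inv p x" using assms(1) by (metis permutes_inverses(2))
    moreover have "inv p x \<in> {1..n}" using that permutes_in_image[OF permutes_inv[OF assms(1)]] by blast
    ultimately show False using assms(2) by (simp add: derangements_def)
  qed
  then show ?thesis using assms conj_permutes[of p] by (simp add: derangements_def)
qed

lemma sum_perm_act_polytabloid:
  assumes lam: "is_partition n lam" and t: "is_tableau lam t"
  shows "(\<Sum>s\<in>derangements n. perm_act s (polytabloid lam t)) = cscale (transversal_sum lam) (polytabloid lam t)"
proof
  fix T
  have n: "n = sum_list lam" using lam by (simp add: is_partition_def)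
  let ?C = "col_stabilizer lam t"
  let ?h = "\<lambda>\<pi> u. of_int (sign \<pi>) * (if T = tabloid lam u then 1 else 0) :: complex"
  have "(\<Sum>s\<in>derangements n. perm_act s (polytabloid lam t)) T =
      (\<Sum>s\<in>derangements n. \<Sum>\<pi>\<in>?C. ?h \<pi> (s \<circ> \<pi> \<circ> t))"
    unfolding sum_fun_apply
    by (intro sum.cong refl perm_act_polytabloid permutes_bij[of _ "{1..n}"]) (simp add: derangements_def)
  also have "\<dots> = (\<Sum>\<pi>\<in>?C. \<Sum>s\<in>derangements n. ?h \<pi> (s \<circ> \<pi> \<circ> t))"
    by (rule sum.swap)
  \<comment> \<open>Centrality: derangements are closed under conjugation, so \<open>s\<close> may
    be replaced by its conjugate by \<open>\<pi>\<close>, which moves \<open>\<pi>\<close> to the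
    left.\<close>
  also have "\<dots> = (\<Sum>\<pi>\<in>?C. \<Sum>s\<in>derangements n. ?h \<pi> (\<pi> \<circ> (s \<circ> t)))"
  proof (rule sum.cong[OF refl])
    fix \<pi> assume "\<pi> \<in> ?C"
    then have \<pi>: "\<pi> permutes {1..n}" by (simp add: col_stabilizer_def n)
    note i\<pi> = permutes_inv[OF \<pi>]
    have o: "inv \<pi> \<circ> \<pi> = id" "\<pi> \<circ> inv \<pi> = id" using permutes_inv_o[OF \<pi>] by auto
    have o': "\<pi> \<circ> (inv \<pi> \<circ> f) = f" "inv \<pi> \<circ> (\<pi> \<circ> f) = f" for f :: "'x \<Rightarrow> nat" by (simp_all add: o flip: comp_assoc)
    show "(\<Sum>s\<in>derangements n. ?h \<pi> (s \<circ> \<pi> \<circ> t)) = (\<Sum>s\<in>derangements n. ?h \<pi> (\<pi> \<circ> (s \<circ> t)))"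
    proof (rule sum.reindex_bij_witness[of _ "\<lambda>s. \<pi> \<circ> s \<circ> inv \<pi>" "\<lambda>s. inv \<pi> \<circ> s \<circ> \<pi>"], goal_cases)
      case (2 s)
      then show ?case using derangement_conj[OF i\<pi>, of s] by (simp add: permutes_inv_inv[OF \<pi>])
    qed (use derangement_conj[OF \<pi>] in \<open>auto simp: comp_assoc o o'\<close>)
  qed
  also have "\<dots> = (\<Sum>s\<in>derangements n. col_antisym lam t (s \<circ> t) T)"
    unfolding col_antisym_def[OF t] by (rule sum.swap)
  also have "\<dots> = cscale (transversal_sum lam) (polytabloid lam t) T"
    by (simp add: sum_col_antisym[OF lam t] cscale_def)
  finally show "(\<Sum>s\<in>derangements n. perm_act s (polytabloid lam t)) T =
      cscale (transversal_sum lam) (polytabloid lam t) T" .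
qed

lemma sum_perm_act_specht:
  assumes lam: "is_partition n lam" and v: "v \<in> specht lam"
  shows "(\<Sum>s\<in>derangements n. perm_act s v) = cscale (transversal_sum lam) v"
  using v unfolding specht_def
proof (induction rule: cfun.span_induct_alt)
  case base
  show ?case by (simp only: perm_act_0 sum.neutral_const cfun.scale_zero_right)
next
  case (step c x y)
  then obtain t where "is_tableau lam t" "x = polytabloid lam t" by blast
  then have x: "(\<Sum>s\<in>derangements n. perm_act s x) = cscale (transversal_sum lam) x"
    using sum_perm_act_polytabloid[OF lam] by blast
  show ?case
    by (simp only: perm_act_add perm_act_scale sum.distrib cfun.scale_right_distrib
        cfun.scale_sum_right[symmetric] x step(2)) (simp only: cfun.scale_left_commute)
qed

lemma perm_act_specht:
  assumes s: "s permutes {1..sum_list lam}" and v: "v \<in> specht lam"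
  shows "perm_act s v \<in> specht lam"
  using v unfolding specht_def
proof (induction rule: cfun.span_induct_alt)
  case base
  show ?case by (simp only: perm_act_0 cfun.span_zero)
next
  case (step c x y)
  then obtain t where t: "is_tableau lam t" "x = polytabloid lam t" by blast
  then have "perm_act s x \<in> cfun.span {polytabloid lam t |t. is_tableau lam t}"
    using perm_act_polytabloid_eq[OF s] is_tableau_comp[OF s] by (auto intro!: cfun.span_base)
  then show ?case unfolding perm_act_add perm_act_scale using step(2) by (intro cfun.span_add cfun.span_scale)
qed

section \<open>Finite dimension, nonvanishing and the trace\<close>

lemma polytabloid_cong:
  assumes "\<And>d. d \<in> diagram lam \<Longrightarrow> t d = t' d"
  shows "polytabloid lam t = polytabloid lam t'"
proof -
  have "tabloid lam (\<pi> \<circ> t) = tabloid lam (\<pi> \<circ> t')" for \<pi>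
    by (simp add: tabloid_def row_set_def assms cong: rev_conj_cong)
  moreover have "col_set lam t j = col_set lam t' j" for j
    by (simp add: col_set_def assms cong: rev_conj_cong)
  ultimately show ?thesis by (simp add: polytabloid_def col_stabilizer_def)
qed

text \<open>Tableaux are arbitrary outside the diagram, so one passes to their restrictions.\<close>

lemma finite_polytabloids: "finite {polytabloid lam t | t. is_tableau lam t}"
proof (rule finite_subset)
  show "{polytabloid lam t | t. is_tableau lam t} \<subseteq>
      polytabloid lam ` (diagram lam \<rightarrow>\<^sub>E {1..sum_list lam})"
  proof clarify
    fix t assume t: "is_tableau lam t"
    have "polytabloid lam t = polytabloid lam (restrict t (diagram lam))" by (rule polytabloid_cong) simp
    moreover have "restrict t (diagram lam) \<in> diagram lam \<rightarrow>\<^sub>E {1..sum_list lam}"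
      using entry_in[OF t] by auto
    ultimately show "polytabloid lam t \<in> polytabloid lam ` (diagram lam \<rightarrow>\<^sub>E {1..sum_list lam})" by blast
  qed
  show "finite (polytabloid lam ` (diagram lam \<rightarrow>\<^sub>E {1..sum_list lam}))"
    by (intro finite_imageI finite_PiE finite_diagram) simp
qed

text \<open>Its own tabloid has coefficient 1, because a permutation preserving all rows and columns
  is the identity. Hence the degree in \<open>eta\<close> is not zero.\<close>

lemma polytabloid_nonzero:
  assumes t: "is_tableau lam t"
  shows "polytabloid lam t \<noteq> 0"
proof -
  have only: "\<pi> = id" if \<pi>: "\<pi> \<in> col_stabilizer lam t" and eq: "tabloid lam t = tabloid lam (\<pi> \<circ> t)" for \<pi>
  proof
    fix x
    have perm: "\<pi> permutes {1..sum_list lam}" using \<pi> by (simp add: col_stabilizer_def)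
    show "\<pi> x = id x"
    proof (cases "x \<in> {1..sum_list lam}")
      case x: True
      then have \<pi>x: "\<pi> x \<in> {1..sum_list lam}" using permutes_in_image[OF perm] by blast
      have "x \<in> col_set lam t (entry_col lam t x)" using x col_set_eq[OF t] by simp
      then have "\<pi> x \<in> \<pi> ` col_set lam t (entry_col lam t x)" by blast
      then have "\<pi> x \<in> col_set lam t (entry_col lam t x)"
        using \<pi> by (simp add: col_stabilizer_def)
      then have c: "entry_col lam t (\<pi> x) = entry_col lam t x" using col_set_eq[OF t] by auto
      have "entry_row lam t x < length lam"
        using entry_pos_in[OF t x] by (auto simp: diagram_def case_prod_beta)
      then have "row_set lam t (entry_row lam t x) = \<pi> ` row_set lam t (entry_row lam t x)"
        using eq by (simp add: tabloid_def row_set_comp)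
      moreover have "x \<in> row_set lam t (entry_row lam t x)" using x row_set_eq[OF t] by auto
      ultimately have "\<pi> x \<in> row_set lam t (entry_row lam t x)" by blast
      then have "entry_row lam t (\<pi> x) = entry_row lam t x" using row_set_eq[OF t] by auto
      then show ?thesis using c entry_pos_inj[OF t \<pi>x x] by (simp add: prod_eq_iff)
    qed (use permutes_not_in[OF perm] in simp)
  qed
  have id: "id \<in> col_stabilizer lam t" by (simp add: col_stabilizer_def)
  have "polytabloid lam t (tabloid lam t) = (\<Sum>\<pi>\<in>col_stabilizer lam t. if \<pi> = id then 1 else 0)"
    unfolding polytabloid_def using only by (intro sum.cong refl) auto
  also have "\<dots> = 1" using id finite_col_stabilizer[OF t] by simp
  finally show ?thesis by auto
qed

text \<open>The derangement sum acts as a scalar, so its trace is the dimension times this scalar,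
  and \<open>irr_char lam id\<close> is the dimension.\<close>

lemma eta_eq:
  assumes lam: "is_partition n lam"
  shows "eta lam = transversal_sum lam"
proof -
  have n: "n = sum_list lam" using lam by (simp add: is_partition_def)
  define B where "B = (SOME B. is_basis B (specht lam))"
  have "\<exists>B. is_basis B (specht lam)"
  proof -
    obtain B where B: "B \<subseteq> specht lam" "cfun.independent B" "specht lam \<subseteq> cfun.span B"
      using cfun.maximal_independent_subset by blast
    have "cfun.span B \<subseteq> specht lam"
      using B(1) by (intro cfun.span_minimal) (auto simp: specht_def)
    then show ?thesis using B by (auto simp: is_basis_def)
  qed
  then have "is_basis B (specht lam)" unfolding B_def by (rule someI_ex)
  then have ind: "cfun.independent B" and span: "cfun.span B = specht lam" by (auto simp: is_basis_def)
  have BV: "b \<in> specht lam" if "b \<in> B" for b using span that cfun.span_base by blast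
  have fin: "finite B"
    using cfun.independent_span_bound[OF finite_polytabloids[of lam] ind] BV
    unfolding specht_def by blast
  have "B \<noteq> {}"
  proof
    assume "B = {}"
    obtain t where t: "is_tableau lam t" using ex_tableau by blast
    then have "polytabloid lam t \<in> specht lam" unfolding specht_def by (blast intro: cfun.span_base)
    then show False using polytabloid_nonzero[OF t] \<open>B = {}\<close> unfolding span[symmetric] by simp
  qed
  then have card: "of_nat (card B) \<noteq> (0 :: complex)" using fin by simp
  have irr: "irr_char lam s = (\<Sum>b\<in>B. cfun.representation B (perm_act s b) b)" for s
    by (simp add: irr_char_def trace_on_def B_def Let_def)
  have "(\<Sum>s\<in>derangements n. irr_char lam s) =
      (\<Sum>b\<in>B. \<Sum>s\<in>derangements n. cfun.representation B (perm_act s b) b)"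
    unfolding irr by (rule sum.swap)
  also have "\<dots> = (\<Sum>b\<in>B. transversal_sum lam)"
  proof (intro sum.cong refl)
    fix b assume b: "b \<in> B"
    have "perm_act s b \<in> cfun.span B" if "s \<in> derangements n" for s
      using that perm_act_specht[of s lam b] BV[OF b] unfolding span by (simp add: derangements_def n)
    then have "(\<Sum>s\<in>derangements n. cfun.representation B (perm_act s b) b) =
        cfun.representation B (\<Sum>s\<in>derangements n. perm_act s b) b"
      using cfun.representation_sum[OF ind, of "derangements n" "\<lambda>s. perm_act s b"] by simp
    also have "\<dots> = cfun.representation B (cscale (transversal_sum lam) b) b"
      using sum_perm_act_specht[OF lam BV[OF b]] by simp
    also have "\<dots> = transversal_sum lam"
      using cfun.representation_scale[OF ind cfun.span_base[OF b]] cfun.representation_basis[OF ind b] by simp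
    finally show "(\<Sum>s\<in>derangements n. cfun.representation B (perm_act s b) b) = transversal_sum lam" .
  qed
  finally have 1: "(\<Sum>s\<in>derangements n. irr_char lam s) = of_nat (card B) * transversal_sum lam" by simp
  have "irr_char lam id = of_nat (card B)"
    unfolding irr by (simp add: perm_act_id cfun.representation_basis[OF ind])
  then show ?thesis using 1 card by (simp add: eta_def n)
qed

section \<open>Column heights and the eigenvalue\<close>

text \<open>Expanding the product, each column offers one of its cells or -1, so the sign counts the
  columns without a cell. The list is reversed because the induction adds the last column, while the
  recursion consumes the head.\<close>

lemma partial_choice_sum_transversals:
  fixes c :: "nat \<Rightarrow> nat"
  shows "partial_choice_sum w (rev (map c [0..<m])) \<mu> =
    (\<Sum>B | B \<subseteq> {(i, j). j < m \<and> i < c j} \<and> inj_on snd B.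
      (-1) ^ (m + card B) * w (\<lambda>i. \<mu> i + card {x \<in> B. fst x = i}))"
proof (induction m arbitrary: \<mu>)
  case 0
  have "{B. B \<subseteq> {(i, j). j < (0::nat) \<and> i < c j} \<and> inj_on snd B} = {{}}" by auto
  then show ?case by simp
next
  case (Suc m)
  let ?cells = "\<lambda>m. {(i, j). j < m \<and> i < c j}"
  let ?Tr = "\<lambda>m. {B. B \<subseteq> ?cells m \<and> inj_on snd B}"
  let ?g = "\<lambda>m \<mu> B. (-1) ^ (m + card B) * w (\<lambda>i. \<mu> i + card {x \<in> B. fst x = i})"
  let ?ins = "\<lambda>(i, B). insert (i, m) B"
  have fin_cells: "finite (?cells m)" for m
  proof -
    have "?cells m = (\<Union>j<m. (\<lambda>i. (i, j)) ` {..<c j})" by auto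
    then show ?thesis by simp
  qed
  have fin: "finite (?Tr m)" for m
    by (rule finite_subset[of _ "Pow (?cells m)"]) (auto simp: fin_cells)
  have notin: "(i, m) \<notin> B" "finite B" if "B \<in> ?Tr m" for i B
    using that finite_subset[OF _ fin_cells[of m]] by auto
  have inj: "inj_on ?ins ({..<c m} \<times> ?Tr m)"
  proof (rule inj_onI)
    fix u v assume u: "u \<in> {..<c m} \<times> ?Tr m" and v: "v \<in> {..<c m} \<times> ?Tr m" and eq: "?ins u = ?ins v"
    obtain i B i' B' where uv: "u = (i, B)" "v = (i', B')" by fastforce
    have eq': "insert (i, m) B = insert (i', m) B'" using eq uv by simp
    have "B \<in> ?Tr m" "B' \<in> ?Tr m" using u v uv by auto
    note nB = notin(1)[OF this(1)] notin(1)[OF this(2)]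
    have "i = i'" using eq' nB by blast
    moreover have "B = B'" using eq' nB \<open>i = i'\<close> by (metis insert_ident)
    ultimately show "u = v" using uv by simp
  qed
  \<comment> \<open>A transversal of \<open>Suc m\<close> columns either avoids column
    \<open>m\<close> or has exactly one cell in it.\<close>
  have Tr_Suc: "?Tr (Suc m) = ?Tr m \<union> ?ins ` ({..<c m} \<times> ?Tr m)"
  proof (intro set_eqI iffI)
    fix B assume B: "B \<in> ?Tr (Suc m)"
    show "B \<in> ?Tr m \<union> ?ins ` ({..<c m} \<times> ?Tr m)"
    proof (cases "\<exists>i. (i, m) \<in> B")
      case False
      then have "B \<subseteq> ?cells m" using B by (auto simp: less_Suc_eq)
      then show ?thesis using B by auto
    next
      case True
      then obtain i where i: "(i, m) \<in> B" by blast
      then have "i < c m" using B by auto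
      have other: "(i', m) \<notin> B - {(i, m)}" for i'
        using B i by (auto dest: inj_onD[of snd B "(i', m)" "(i, m)"])
      have "B - {(i, m)} \<subseteq> ?cells m"
      proof (rule subrelI)
        fix a b assume ab: "(a, b) \<in> B - {(i, m)}"
        then have "b \<noteq> m" using other[of a] by auto
        then show "(a, b) \<in> ?cells m" using ab B by (auto simp: less_Suc_eq)
      qed
      moreover have "inj_on snd (B - {(i, m)})" using B by (auto intro: inj_on_subset)
      ultimately have "(i, B - {(i, m)}) \<in> {..<c m} \<times> ?Tr m" using \<open>i < c m\<close> by simp
      moreover have "B = ?ins (i, B - {(i, m)})" using i by auto
      ultimately show ?thesis by blast
    qed
  next
    fix B assume "B \<in> ?Tr m \<union> ?ins ` ({..<c m} \<times> ?Tr m)"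
    then show "B \<in> ?Tr (Suc m)"
    proof
      assume "B \<in> ?Tr m"
      then show ?thesis by (auto simp: less_Suc_eq)
    next
      assume "B \<in> ?ins ` ({..<c m} \<times> ?Tr m)"
      then obtain i B' where B: "B = insert (i, m) B'" and i: "i < c m" and B': "B' \<in> ?Tr m" by auto
      have "m \<notin> snd ` B'" using B' by force
      then show ?thesis using B i B' by (auto simp: less_Suc_eq)
    qed
  qed
  have disj: "?Tr m \<inter> ?ins ` ({..<c m} \<times> ?Tr m) = {}"
    using notin by auto
  have ins: "?g (Suc m) \<mu> (insert (i, m) B) = ?g m (bump i \<mu>) B" if "B \<in> ?Tr m" for i B
  proof -
    have "card {x \<in> insert (i, m) B. fst x = k} = card {x \<in> B. fst x = k} + (if k = i then 1 else 0)" for k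
    proof (cases "k = i")
      case True
      have "{x \<in> insert (i, m) B. fst x = k} = insert (i, m) {x \<in> B. fst x = k}" using True by auto
      then show ?thesis using notin[OF that] True by simp
    next
      case False
      then have "{x \<in> insert (i, m) B. fst x = k} = {x \<in> B. fst x = k}" by auto
      then show ?thesis using False by simp
    qed
    then have "(\<lambda>k. \<mu> k + card {x \<in> insert (i, m) B. fst x = k}) =
        (\<lambda>k. bump i \<mu> k + card {x \<in> B. fst x = k})"
      by (auto simp: bump_def)
    then show ?thesis using notin[OF that] by simp
  qed
  have "(\<Sum>B\<in>?Tr (Suc m). ?g (Suc m) \<mu> B) =
      (\<Sum>B\<in>?Tr m. ?g (Suc m) \<mu> B) + (\<Sum>B\<in>?ins ` ({..<c m} \<times> ?Tr m). ?g (Suc m) \<mu> B)"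
    unfolding Tr_Suc using fin disj by (intro sum.union_disjoint) auto
  also have "(\<Sum>B\<in>?ins ` ({..<c m} \<times> ?Tr m). ?g (Suc m) \<mu> B) =
      (\<Sum>i<c m. \<Sum>B\<in>?Tr m. ?g (Suc m) \<mu> (insert (i, m) B))"
    unfolding sum.reindex[OF inj] sum.cartesian_product by (rule sum.cong) auto
  also have "\<dots> = (\<Sum>i<c m. \<Sum>B\<in>?Tr m. ?g m (bump i \<mu>) B)"
    using ins by (intro sum.cong refl) blast
  also have "(\<Sum>B\<in>?Tr m. ?g (Suc m) \<mu> B) = - (\<Sum>B\<in>?Tr m. ?g m \<mu> B)"
    by (simp add: sum_negf)
  finally show ?case by (simp add: Suc)
qed

section \<open>The conjugate partition and the reversal of dominance\<close>

definition col_height :: "nat list \<Rightarrow> nat \<Rightarrow> nat" where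
  "col_height lam j = card {i. j < part lam i}"

lemma finite_part_gt: "finite {i. j < part lam i}"
  by (rule finite_subset[of _ "{..<length lam}"]) (auto simp: part_def split: if_splits)

context
  fixes n :: nat and lam :: "nat list"
  assumes lam: "is_partition n lam"
begin

lemma part_antimono: "i \<le> j \<Longrightarrow> part lam j \<le> part lam i"
  using lam by (cases "i = j") (auto simp: is_partition_def part_def sorted_wrt_iff_nth_less)

text \<open>The rows that reach column \<open>j\<close> form an initial segment.\<close>

lemma less_col_height_iff: "i < col_height lam j \<longleftrightarrow> j < part lam i"
proof
  assume "j < part lam i"
  then have "{..i} \<subseteq> {i. j < part lam i}" using part_antimono less_le_trans by blast
  from card_mono[OF finite_part_gt this] show "i < col_height lam j" by (simp add: col_height_def)
next
  assume i: "i < col_height lam j"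
  show "j < part lam i"
  proof (rule ccontr)
    assume neg: "\<not> ?thesis"
    have "{i. j < part lam i} \<subseteq> {..<i}"
    proof clarify
      fix k assume "j < part lam k"
      then show "k < i" using neg part_antimono[of i k] by (cases "k < i") auto
    qed
    from card_mono[OF finite_lessThan this] show False using i by (simp add: col_height_def)
  qed
qed

lemma diagram_eq: "diagram lam = {(i, j). j < part lam 0 \<and> i < col_height lam j}"
proof -
  have "(i, j) \<in> diagram lam \<longleftrightarrow> j < part lam i" for i j by (simp add: diagram_def part_def)
  moreover have "j < part lam 0" if "j < part lam i" for i j
    using part_antimono[of 0 i] that by simp
  ultimately show ?thesis unfolding less_col_height_iff by auto
qed

lemma col_height_le: "col_height lam j \<le> length lam"
proof -
  have "{i. j < part lam i} \<subseteq> {..<length lam}" by (auto simp: part_def split: if_splits)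
  from card_mono[OF finite_lessThan this] show ?thesis by (simp add: col_height_def)
qed

lemma col_height_antimono: "j \<le> k \<Longrightarrow> col_height lam k \<le> col_height lam j"
  unfolding col_height_def by (intro card_mono finite_part_gt) auto

lemma col_height_pos: "j < part lam 0 \<Longrightarrow> 1 \<le> col_height lam j"
  using less_col_height_iff[of 0 j] by simp

lemma sum_part: "length lam \<le> N \<Longrightarrow> (\<Sum>i<N. part lam i) = n"
proof -
  assume N: "length lam \<le> N"
  have "(\<Sum>i<N. part lam i) = (\<Sum>i<length lam. part lam i)"
    using N by (intro sum.mono_neutral_right) (auto simp: part_def)
  also have "\<dots> = sum_list lam" by (simp add: part_def sum_list_sum_nth atLeast0LessThan)
  finally show ?thesis using lam by (simp add: is_partition_def)
qed

text \<open>The cells of the first \<open>k\<close> columns, counted by columns and by rows.\<close>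

lemma sum_col_height:
  assumes "length lam \<le> N"
  shows "(\<Sum>j<k. col_height lam j) = (\<Sum>i<N. min (part lam i) k)"
proof -
  have "col_height lam j = (\<Sum>i<N. if j < part lam i then 1 else 0)" for j
  proof -
    have "{i. j < part lam i} = {i \<in> {..<N}. j < part lam i}"
      using assms by (auto simp: part_def split: if_splits)
    then show ?thesis by (simp add: col_height_def sum.If_cases Int_def)
  qed
  then have "(\<Sum>j<k. col_height lam j) = (\<Sum>i<N. \<Sum>j<k. if j < part lam i then 1 else 0)"
    by (simp add: sum.swap[of _ "{..<k}"])
  also have "\<dots> = (\<Sum>i<N. min (part lam i) k)"
  proof (intro sum.cong refl)
    fix i
    have "{..<k} \<inter> {j. j < part lam i} = {..<min (part lam i) k}" by auto
    then show "(\<Sum>j<k. if j < part lam i then 1 else 0) = min (part lam i) k"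
      by (simp add: sum.If_cases)
  qed
  finally show ?thesis .
qed

text \<open>All terms share the sign \<open>(-1) ^ (n + part lam 0)\<close>, which the norm removes.
  The bound \<open>N\<close> stays free so that two partitions can use the same weight.\<close>

lemma norm_eta:
  assumes N: "length lam \<le> N" "1 \<le> N"
  shows "norm (eta lam) = choice_sum (derange_weight N) (map (col_height lam) [0..<part lam 0]) (\<lambda>_. 0)"
proof -
  let ?m = "part lam 0" and ?c = "col_height lam"
  let ?cs = "map ?c [0..<?m]"
  have n: "n = sum_list lam" using lam by (simp add: is_partition_def)
  have "transversal_sum lam = (\<Sum>B | B \<subseteq> diagram lam \<and> inj_on snd B. of_real
      ((-1) ^ (n + ?m) * ((-1) ^ (?m + card B) * fact_weight N (\<lambda>i. 0 + card {x \<in> B. fst x = i}))))"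
    unfolding transversal_sum_def
  proof (intro sum.cong refl, clarify)
    fix B assume B: "B \<subseteq> diagram lam"
    have fin: "finite B" using B finite_diagram finite_subset by blast
    have "card (diagram lam - B) + card B = n"
      using B card_diagram[of lam] card_mono[OF finite_diagram B] by (simp add: card_Diff_subset fin n)
    then have "(-1 :: complex) ^ card (diagram lam - B) = (-1) ^ (n + ?m) * (-1) ^ (?m + card B)"
      by (auto simp: power_add simp flip: power_mult_distrib)
    moreover have "fact_weight N (\<lambda>i. 0 + card {x \<in> B. fst x = i}) =
        (\<Prod>i<length lam. fact (card {x \<in> B. fst x = i}))"
      unfolding fact_weight_def
    proof (rule prod.mono_neutral_cong_right)
      \<comment> \<open>Rows beyond the diagram contribute \<open>fact 0 = 1\<close>.\<close>
      have "card {x \<in> B. fst x = i} = 0" if "i \<notin> {..<length lam}" for i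
      proof -
        have "{x \<in> B. fst x = i} = {}" using B that by (auto simp: diagram_def)
        then show ?thesis by (simp only: card.empty)
      qed
      then show "\<forall>i\<in>{..<N} - {..<length lam}. fact (0 + card {x \<in> B. fst x = i}) = (1 :: real)" by simp
    qed (use N in auto)
    ultimately show "(-1) ^ card (diagram lam - B) * (\<Prod>i<length lam. fact (card {x \<in> B. fst x = i})) =
      complex_of_real ((-1) ^ (n + ?m) * ((-1) ^ (?m + card B) * fact_weight N (\<lambda>i. 0 + card {x \<in> B. fst x = i})))"
      by simp
  qed
  also have "\<dots> = of_real ((-1) ^ (n + ?m) * partial_choice_sum (fact_weight N) (rev ?cs) (\<lambda>_. 0))"
    unfolding partial_choice_sum_transversals diagram_eq of_real_sum[symmetric] sum_distrib_left[symmetric] ..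
  finally have "norm (eta lam) = \<bar>partial_choice_sum (fact_weight N) (rev ?cs) (\<lambda>_. 0)\<bar>"
    unfolding eta_eq[OF lam] by (simp add: norm_mult norm_power)
  also have "partial_choice_sum (fact_weight N) (rev ?cs) (\<lambda>_. 0) = choice_sum (derange_weight N) (rev ?cs) (\<lambda>_. 0)"
    using N col_height_pos by (intro partial_choice_sum_eq) auto
  also have "\<dots> = choice_sum (derange_weight N) ?cs (\<lambda>_. 0)"
    by (rule choice_sum_mset_cong) simp
  finally show ?thesis by (simp add: choice_sum_nonneg)
qed

end

lemma partition_eqI:
  assumes lam: "is_partition n lam" and lam': "is_partition n lam'"
    and eq: "\<And>i. part lam i = part lam' i"
  shows "lam = lam'"
proof -
  have "i < length mu \<longleftrightarrow> 0 < part mu i" if "is_partition n mu" for i mu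
  proof (cases "i < length mu")
    case True
    then have "1 \<le> mu ! i" using that by (simp add: is_partition_def)
    then show ?thesis using True by (simp add: part_def)
  qed (simp add: part_def)
  then have "i < length lam \<longleftrightarrow> i < length lam'" for i using lam lam' eq by metis
  then have "length lam = length lam'" by (metis less_irrefl nat_neq_iff)
  then show ?thesis
  proof (rule nth_equalityI)
    show "lam ! i = lam' ! i" if "i < length lam" for i
      using eq[of i] that \<open>length lam = length lam'\<close> by (simp add: part_def)
  qed
qed

text \<open>Conjugation reverses dominance. The number of cells beyond the first \<open>k\<close>
  columns is the maximum over \<open>r\<close> of (sum of the first \<open>r\<close> parts) -
  \<open>r * k\<close>. For \<open>lam\<close> it is attained at
  \<open>r = col_height lam k\<close>, and the same \<open>r\<close> bounds the number for
  \<open>lam'\<close> from below.\<close>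

lemma sum_col_height_dominated:
  assumes lam: "is_partition n lam" and lam': "is_partition n lam'" and dom: "dominated_by lam lam'"
  shows "(\<Sum>j<k. col_height lam' j) \<le> (\<Sum>j<k. col_height lam j)"
proof -
  define N where "N = length lam + length lam'"
  have N: "length lam \<le> N" "length lam' \<le> N" by (auto simp: N_def)
  let ?r = "col_height lam k"
  have r: "?r \<le> N" using col_height_le[OF lam] N by (meson le_trans)
  have split: "(\<Sum>j<k. col_height mu j) + (\<Sum>i<N. part mu i - k) = n"
    if "is_partition n mu" "length mu \<le> N" for mu
  proof -
    have "(\<Sum>i<N. min (part mu i) k) + (\<Sum>i<N. part mu i - k) = (\<Sum>i<N. part mu i)"
      unfolding sum.distrib[symmetric] by (intro sum.cong) auto
    then show ?thesis using that by (simp add: sum_col_height[OF that] sum_part[OF that])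
  qed
  have gt: "i < ?r \<longleftrightarrow> k < part lam i" for i by (rule less_col_height_iff[OF lam])
  have "part lam i - k = 0" if "\<not> i < ?r" for i using that unfolding gt by simp
  then have "(\<Sum>i<N. part lam i - k) = (\<Sum>i<?r. part lam i - k)"
    using r by (intro sum.mono_neutral_right) auto
  also have "\<dots> + ?r * k = (\<Sum>i<?r. part lam i)"
  proof -
    have "(\<Sum>i<?r. part lam i) = (\<Sum>i<?r. (part lam i - k) + k)"
      using gt by (intro sum.cong refl) fastforce
    then show ?thesis by (simp add: sum.distrib)
  qed
  finally have 1: "(\<Sum>i<N. part lam i - k) + ?r * k = (\<Sum>i<?r. part lam i)" .
  \<comment> \<open>The case \<open>?r = 0\<close> is separate because \<open>dominated_by\<close>
    speaks of \<open>k \<ge> 1\<close> only.\<close>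
  have "(\<Sum>i<?r. part lam i) \<le> (\<Sum>i<?r. part lam' i)"
    using dom by (cases "?r = 0") (auto simp: dominated_by_def)
  also have "\<dots> \<le> (\<Sum>i<?r. (part lam' i - k) + k)" by (intro sum_mono) auto
  also have "\<dots> = (\<Sum>i<?r. part lam' i - k) + ?r * k" by (simp add: sum.distrib)
  also have "(\<Sum>i<?r. part lam' i - k) \<le> (\<Sum>i<N. part lam' i - k)"
    using r by (intro sum_mono2) auto
  finally have "(\<Sum>i<N. part lam i - k) \<le> (\<Sum>i<N. part lam' i - k)" using 1 by simp
  then show ?thesis using split[OF lam N(1)] split[OF lam' N(2)] by simp
qed

text \<open>Strictness fails for equal partitions, as dominance is reflexive, and can fail in the
  excluded case: for \<open>[3,1,1]\<close> and \<open>[3,2]\<close> both norms are 4.\<close>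

theorem theorem1p6:
  fixes n :: nat and lam lam' :: "nat list"
  assumes "is_partition n lam" and "is_partition n lam'"
    and "part lam 0 = part lam' 0"
    and "dominated_by lam lam'"
  shows "norm (eta lam) \<le> norm (eta lam') \<and>
    (lam \<noteq> lam' \<and> \<not> (part lam' 0 = 3 \<and> part lam' 1 \<le> 2)
      \<longrightarrow> norm (eta lam) < norm (eta lam'))"
proof -
  note lam = assms(1) and lam' = assms(2)
  define m where "m = part lam 0"
  have m': "part lam' 0 = m" using assms(3) by (simp add: m_def)
  \<comment> \<open>A common bound for both weights; \<open>Suc\<close> keeps it positive even for
    empty partitions.\<close>
  define N where "N = Suc (length lam + length lam')"
  let ?c = "col_height lam" and ?c' = "col_height lam'"
  let ?F = "\<lambda>d. choice_sum (derange_weight N) (map d [0..<m]) (\<lambda>_. 0)"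
  have N: "length lam \<le> N" "length lam' \<le> N" "1 \<le> N" by (auto simp: N_def)
  have F: "norm (eta lam) = ?F ?c" "norm (eta lam') = ?F ?c'"
    using norm_eta[OF lam N(1,3)] norm_eta[OF lam' N(2,3)] by (simp_all add: m_def assms(3))
  have "?F ?c \<le> ?F ?c' \<and> ((\<exists>j<m. ?c j \<noteq> ?c' j) \<and> \<not> (m = 3 \<and> ?c' 2 = 1) \<longrightarrow> ?F ?c < ?F ?c')"
  proof (rule choice_sum_dominance)
    show "1 \<le> ?c j" if "j < m" for j using col_height_pos[OF lam] that by (simp add: m_def)
    show "1 \<le> ?c' j" if "j < m" for j using col_height_pos[OF lam'] that by (simp add: m')
    show "?c j \<le> N" for j using col_height_le[OF lam] N by (meson le_trans)
    show "?c' j \<le> N" for j using col_height_le[OF lam'] N by (meson le_trans)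
    show "?c' j \<le> ?c' i" if "i \<le> j" for i j using col_height_antimono[OF lam'] that by simp
    show "(\<Sum>j<k. ?c' j) \<le> (\<Sum>j<k. ?c j)" for k by (rule sum_col_height_dominated[OF lam lam' assms(4)])
    have "(\<Sum>j<m. col_height mu j) = n" if "is_partition n mu" "length mu \<le> N" "part mu 0 = m" for mu
    proof -
      have "min (part mu i) m = part mu i" for i using part_antimono[OF that(1), of 0 i] that(3) by simp
      then show ?thesis by (simp add: sum_col_height[OF that(1,2)] sum_part[OF that(1,2)])
    qed
    then show "(\<Sum>j<m. ?c' j) = (\<Sum>j<m. ?c j)" using lam lam' N m' by (simp add: m_def)
  qed
  moreover have "\<exists>j<m. ?c j \<noteq> ?c' j" if "lam \<noteq> lam'"
  proof (rule ccontr)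
    assume "\<not> ?thesis"
    then have eq: "?c j = ?c' j" if "j < m" for j using that by blast
    have "j < part lam i \<longleftrightarrow> j < part lam' i" for i j
    proof (cases "j < m")
      case True
      then show ?thesis using eq less_col_height_iff[OF lam] less_col_height_iff[OF lam'] by metis
    next
      case False
      then show ?thesis using part_antimono[OF lam, of 0 i] part_antimono[OF lam', of 0 i] m' by (simp add: m_def)
    qed
    then have "part lam i = part lam' i" for i by (metis less_irrefl nat_neq_iff)
    then show False using partition_eqI[OF lam lam'] that by blast
  qed
  \<comment> \<open>Column 2 has height 1 only if row 1 does not reach it, that is,
    \<open>part lam' 1 \<le> 2\<close>.\<close>
  moreover have "\<not> (m = 3 \<and> ?c' 2 = 1)" if "\<not> (part lam' 0 = 3 \<and> part lam' 1 \<le> 2)"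
    using that less_col_height_iff[OF lam', of 1 2] m' by auto
  ultimately show ?thesis unfolding F by blast
qed

end
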